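(* Let $G$ be a minimal matching covered graph with at least four vertices. Then $\delta(G)=2$ or $\delta(G)=3$.
   Context: Graphs are finite and may have multiple edges but no loops. A connected graph with at least two vertices is matching covered if each of its edges lies in a perfect matching. A matching covered graph $G$ is minimal if, for every edge $e$ of $G$, the graph $G-e$ is not matching covered. $\delta(G)$ denotes the minimum degree of $G$ (degree counts incident edges, with multiplicity). *)

theory Defs
  imports Main
begin

(* Undirected multigraphs: edges are named objects and "ends" gives the set of ends
   of an edge, so parallel edges are distinct names with the same set of ends. *)
record ('v, 'e) multigraph =
  vertices :: "'v set"
  edges :: "'e set"
  ends :: "'e \<Rightarrow> 'v set"

(* Two ends for each edge: no loops. *)
definition loopless_multigraph :: "('v, 'e) multigraph \<Rightarrow> bool" where
  "loopless_multigraph G \<longleftrightarrow>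
     finite (vertices G) \<and> finite (edges G) \<and>
     (\<forall>e\<in>edges G. ends G e \<subseteq> vertices G \<and> card (ends G e) = 2)"

definition adjacency :: "('v, 'e) multigraph \<Rightarrow> ('v \<times> 'v) set" where
  "adjacency G = {(u, v). \<exists>e\<in>edges G. ends G e = {u, v}}"

definition connected_graph :: "('v, 'e) multigraph \<Rightarrow> bool" where
  "connected_graph G \<longleftrightarrow>
     vertices G \<noteq> {} \<and> (\<forall>u\<in>vertices G. \<forall>v\<in>vertices G. (u, v) \<in> (adjacency G)\<^sup>*)"

definition matching :: "('v, 'e) multigraph \<Rightarrow> 'e set \<Rightarrow> bool" where
  "matching G M \<longleftrightarrow>
     M \<subseteq> edges G \<and> (\<forall>e\<in>M. \<forall>f\<in>M. e \<noteq> f \<longrightarrow> ends G e \<inter> ends G f = {})"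

definition perfect_matching :: "('v, 'e) multigraph \<Rightarrow> 'e set \<Rightarrow> bool" where
  "perfect_matching G M \<longleftrightarrow>
     matching G M \<and> (\<forall>v\<in>vertices G. \<exists>e\<in>M. v \<in> ends G e)"

definition matching_covered :: "('v, 'e) multigraph \<Rightarrow> bool" where
  "matching_covered G \<longleftrightarrow>
     connected_graph G \<and> card (vertices G) \<ge> 2 \<and>
     (\<forall>e\<in>edges G. \<exists>M. perfect_matching G M \<and> e \<in> M)"

definition delete_edge :: "('v, 'e) multigraph \<Rightarrow> 'e \<Rightarrow> ('v, 'e) multigraph" where
  "delete_edge G e = G\<lparr>edges := edges G - {e}\<rparr>"

definition minimal_matching_covered :: "('v, 'e) multigraph \<Rightarrow> bool" where
  "minimal_matching_covered G \<longleftrightarrow>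
     matching_covered G \<and> (\<forall>e\<in>edges G. \<not> matching_covered (delete_edge G e))"

definition vertex_degree :: "('v, 'e) multigraph \<Rightarrow> 'v \<Rightarrow> nat" where
  "vertex_degree G v = card {e \<in> edges G. v \<in> ends G e}"

definition min_degree :: "('v, 'e) multigraph \<Rightarrow> nat" where
  "min_degree G = Min (vertex_degree G ` vertices G)"

end

theory Submission
  imports Defs
begin

text \<open>Say that an edge \<open>f\<close> depends on \<open>e\<close> if every perfect matching through \<open>f\<close> also contains \<open>e\<close>, and call
\<open>e\<close> solo if no other edge depends on it. In a matching covered graph with at least three vertices
a solo edge can be deleted (\<open>solo_edge_removable\<close>), so a minimal graph has no solo edge. Degrees
at least 2 are immediate; the point is that minimum degree at least 4 forces a solo edge.

The induction needs one exceptional vertex \<open>x\<close>: if all vertices other than \<open>x\<close> have degree at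
least 4 and all solo edges are at \<open>x\<close>, then for every edge \<open>e\<close> some solo \<open>r\<close> depends on \<open>e\<close> (\<open>solo_edges_dominate\<close>). Two edges at \<open>x\<close> never share
a perfect matching, so then all edges at \<open>x\<close> are solo, and perfect matchings through them, one
for each, cover all edges; in particular \<open>x\<close> has the largest degree (\<open>solo_edges_star\<close>). This is what
makes the statement inductive: it says that a contracted vertex again has degree at least 4.

For the proof of the induction step, suppose some edge has no solo edge above it. Dependence is a
preorder; read "\<open>r\<close> is above \<open>e\<close>" as "\<open>r\<close> depends on \<open>e\<close>". So there is a source edge \<open>e\<close> above it, one
that in turn depends on every edge that depends on it. As \<open>e\<close> is not solo, some \<open>f \<noteq> e\<close> is equivalent
to \<open>e\<close>: the two lie in the same perfect matchings. Deleting \<open>e\<close> and the ends of \<open>f\<close> leaves a graph without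
perfect matching, and the Berge formula (\<open>berge\<close>) gives a barrier \<open>B\<close> that contains \<open>f\<close> and a partition of the
rest into \<open>card B\<close> odd parts. Counting shows that \<open>f\<close> is the only edge inside \<open>B\<close>, that \<open>e\<close> is the only
edge between different parts, and that the boundary of every part is a tight cut, one that
each perfect matching meets exactly once (\<open>barrier_of_dependent_pair\<close>).

If some part \<open>X\<close> is not a single vertex, contract it. Dependence between edges of a tight cut
contraction is the same as in \<open>G\<close>, and an edge that is solo in the contractions containing it is solo
in \<open>G\<close>. If \<open>x\<close> lies outside \<open>X\<close>, the other contraction, in which the complement of \<open>X\<close> becomes \<open>x\<close>, satisfies
the induction hypothesis, so the cut has at least 4 edges and they are all solo there. Therefore
contracting \<open>X\<close> again gives a graph of the same kind, and in it a solo edge lies above both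
\<open>e\<close> and \<open>f\<close>, which are equivalent to it because \<open>e\<close> is a source; a contradiction.

If all parts are single vertices, \<open>G\<close> without \<open>e\<close> and \<open>f\<close> is bipartite. Let \<open>H\<close> consist of the edges
that do not depend on \<open>e\<close>. On the colour class of \<open>x\<close> there is a vertex \<open>u \<noteq> x\<close> at which at most two
edges of \<open>H\<close> fail to be solo in \<open>H\<close> (\<open>vertex_with_two_unavoidable_arcs\<close>, a statement on directed
graphs). Any other edge at \<open>u\<close> lies in every perfect matching through \<open>e\<close>, so there is at most
one, and \<open>u\<close> has degree at most 3.\<close>

section \<open>Matchings and the Berge formula\<close>

definition covered_by :: "('v, 'e) multigraph \<Rightarrow> 'e set \<Rightarrow> 'v set" where
  "covered_by G M = \<Union> (ends G ` M)"

lemma covered_by_iff: "v \<in> covered_by G M \<longleftrightarrow> (\<exists>e\<in>M. v \<in> ends G e)"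
  unfolding covered_by_def by auto

lemma covered_byI: "e \<in> M \<Longrightarrow> v \<in> ends G e \<Longrightarrow> v \<in> covered_by G M"
  unfolding covered_by_def by auto

lemma covered_by_insert: "covered_by G (insert e M) = ends G e \<union> covered_by G M"
  unfolding covered_by_def by auto

lemma covered_by_mono: "M \<subseteq> N \<Longrightarrow> covered_by G M \<subseteq> covered_by G N"
  unfolding covered_by_def by auto

lemma edge_ends_two:
  assumes "loopless_multigraph G" "e \<in> edges G" "a \<in> ends G e"
  obtains b where "ends G e = {a, b}" "a \<noteq> b" "a \<in> vertices G" "b \<in> vertices G"
proof -
  have 1: "card (ends G e) = 2" "ends G e \<subseteq> vertices G"
    using assms unfolding loopless_multigraph_def by auto
  then obtain c d where "ends G e = {c, d}" "c \<noteq> d" by (auto simp: card_2_iff)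
  then show thesis using that 1(2) assms(3) by (cases "a = c") auto
qed

lemma edge_ends_eq:
  assumes "loopless_multigraph G" "e \<in> edges G" "a \<in> ends G e" "b \<in> ends G e" "a \<noteq> b"
  shows "ends G e = {a, b}"
  using edge_ends_two[OF assms(1-3)] assms(4,5) by blast

lemma matching_finite:
  assumes "loopless_multigraph G" "matching G M"
  shows "finite M" "M \<subseteq> edges G"
  using assms unfolding matching_def loopless_multigraph_def by (auto intro: finite_subset)

lemma matching_subset: "matching G M \<Longrightarrow> N \<subseteq> M \<Longrightarrow> matching G N"
  unfolding matching_def by blast

lemma matching_unique:
  "matching G M \<Longrightarrow> e \<in> M \<Longrightarrow> f \<in> M \<Longrightarrow> v \<in> ends G e \<Longrightarrow> v \<in> ends G f \<Longrightarrow> e = f"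
  unfolding matching_def by blast

lemma matching_insert:
  assumes "matching G M" "e \<in> edges G" "ends G e \<inter> covered_by G M = {}"
  shows "matching G (insert e M)"
proof -
  have "ends G e \<inter> ends G f = {}" if "f \<in> M" for f
    using assms(3) that unfolding covered_by_def by blast
  then show ?thesis using assms(1,2) unfolding matching_def by (simp add: Int_commute)
qed

lemma card_covered_by:
  assumes G: "loopless_multigraph G" and M: "matching G M"
  shows "card (covered_by G M) = 2 * card M"
proof -
  have fin: "finite M" and sub: "M \<subseteq> edges G" using matching_finite[OF G M] .
  have c2: "\<And>e. e \<in> M \<Longrightarrow> card (ends G e) = 2"
    using sub G unfolding loopless_multigraph_def by auto
  have "card (covered_by G M) = (\<Sum>e\<in>M. card (ends G e))"
    unfolding covered_by_def using fin M c2 by (intro card_UN_disjoint) (auto simp: matching_def card_eq_0_iff intro!: card_ge_0_finite)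
  also have "\<dots> = 2 * card M" using c2 by simp
  finally show ?thesis .
qed

lemma covered_by_subset:
  assumes "loopless_multigraph G" "matching G M"
  shows "covered_by G M \<subseteq> vertices G" "finite (covered_by G M)"
proof -
  show "covered_by G M \<subseteq> vertices G"
    using assms unfolding matching_def loopless_multigraph_def covered_by_def by auto
  then show "finite (covered_by G M)"
    using assms unfolding loopless_multigraph_def by (auto intro: finite_subset)
qed

definition maximum_matching :: "('v, 'e) multigraph \<Rightarrow> 'e set \<Rightarrow> bool" where
  "maximum_matching G M \<longleftrightarrow> matching G M \<and> (\<forall>N. matching G N \<longrightarrow> card N \<le> card M)"

lemma maximum_matching_exists:
  assumes G: "loopless_multigraph G"
  obtains M where "maximum_matching G M"
proof -
  have fE: "finite (edges G)" using G unfolding loopless_multigraph_def by auto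
  have 1: "matching G {}" unfolding matching_def by auto
  have 2: "\<And>N. matching G N \<Longrightarrow> card N < Suc (card (edges G))"
    using fE by (simp add: card_mono less_Suc_eq_le matching_def)
  show thesis
    using ex_has_greatest_nat[of "matching G" "{}" card, OF 1] 2 that
    unfolding maximum_matching_def by (metis less_imp_le_nat)
qed

lemma maximum_matching_misses_no_edge:
  assumes G: "loopless_multigraph G" and M: "maximum_matching G M"
    and e: "e \<in> edges G" "ends G e \<inter> covered_by G M = {}"
  shows False
proof -
  have m: "matching G M" using M unfolding maximum_matching_def by auto
  have "ends G e \<noteq> {}" using G e(1) unfolding loopless_multigraph_def by fastforce
  then have "e \<notin> M" using e(2) unfolding covered_by_def by blast
  then have "card (insert e M) = Suc (card M)" using matching_finite[OF G m] by simp
  then show False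
    using M matching_insert[OF m e] unfolding maximum_matching_def by fastforce
qed

text \<open>The exchange argument behind Gallai's lemma. Among the maximum matchings that miss \<open>t\<close> take \<open>N\<close> with the
largest intersection with \<open>M\<close>. As \<open>M\<close> misses both \<open>u\<close> and \<open>v\<close>, which \<open>N\<close> covers, \<open>M\<close> covers some
\<open>y \<noteq> t\<close> that \<open>N\<close> misses; exchanging an edge of \<open>N\<close> for the edge of \<open>M\<close> at \<open>y\<close> enlarges the intersection.\<close>

lemma gallai_exchange:
  assumes G: "loopless_multigraph G"
    and M: "maximum_matching G M"
    and uv: "u \<in> vertices G" "v \<in> vertices G" "u \<noteq> v" "u \<notin> covered_by G M" "v \<notin> covered_by G M"
    and t: "t \<in> covered_by G M"
    and N0: "maximum_matching G N0" "t \<notin> covered_by G N0"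
    and cov: "\<And>N. maximum_matching G N \<Longrightarrow> t \<notin> covered_by G N \<Longrightarrow>
                u \<in> covered_by G N \<and> v \<in> covered_by G N"
  shows False
proof -
  let ?P = "\<lambda>N. maximum_matching G N \<and> t \<notin> covered_by G N"
  have mM: "matching G M" using M unfolding maximum_matching_def by auto
  have fM: "finite M" using matching_finite[OF G mM] by simp
  obtain N where N: "?P N" and Nmax: "\<And>N'. ?P N' \<Longrightarrow> card (M \<inter> N') \<le> card (M \<inter> N)"
    using ex_has_greatest_nat[of ?P N0 "\<lambda>N. card (M \<inter> N)" "Suc (card M)"] N0 fM
    by (metis card_mono inf_le1 le_imp_less_Suc less_imp_le_nat)
  have mN: "matching G N" using N unfolding maximum_matching_def by auto
  have fN: "finite N" using matching_finite[OF G mN] by simp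
  have eqc: "card M = card N" using M N mM mN unfolding maximum_matching_def by (simp add: le_antisym)
  let ?CM = "covered_by G M" and ?CN = "covered_by G N"
  have fC: "finite ?CM" "finite ?CN" using covered_by_subset[OF G] mM mN by auto
  have cc: "card ?CM = card ?CN" using card_covered_by[OF G] mM mN eqc by simp
  have "card (?CM - ?CN) = card (?CN - ?CM)"
  proof -
    have "card (?CM - ?CN) = card ?CM - card (?CM \<inter> ?CN)"
      by (rule card_Diff_subset_Int) (use fC in auto)
    moreover have "card (?CN - ?CM) = card ?CN - card (?CN \<inter> ?CM)"
      by (rule card_Diff_subset_Int) (use fC in auto)
    ultimately show ?thesis using cc by (simp add: Int_commute)
  qed
  moreover have "{u, v} \<subseteq> ?CN - ?CM" using cov N uv by blast
  then have "card {u, v} \<le> card (?CN - ?CM)" using fC by (intro card_mono) auto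
  ultimately have "card (?CM - ?CN) \<ge> 2" using uv(3) by simp
  then have "\<not> ?CM - ?CN \<subseteq> {t}" using card_mono[of "{t}" "?CM - ?CN"] by fastforce
  then obtain y where y: "y \<in> ?CM" "y \<notin> ?CN" "y \<noteq> t" by blast
  then obtain m where m: "m \<in> M" "y \<in> ends G m" unfolding covered_by_iff by blast
  have mE: "m \<in> edges G" using m mM unfolding matching_def by auto
  obtain w where w: "ends G m = {y, w}" "y \<noteq> w" using edge_ends_two[OF G mE m(2)] by metis
  have "w \<in> ?CN"
  proof (rule ccontr)
    assume "w \<notin> ?CN"
    then have "ends G m \<inter> ?CN = {}" using w y by auto
    then show False using maximum_matching_misses_no_edge[OF G _ mE] N by blast
  qed
  then obtain n where n: "n \<in> N" "w \<in> ends G n" unfolding covered_by_iff by blast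
  have nM: "n \<notin> M"
  proof
    assume "n \<in> M"
    then have "n = m" using matching_unique[OF mM] m n w by blast
    then show False using n(1) y(2) m(2) covered_byI by metis
  qed
  have mnN: "m \<notin> N" using y(2) m(2) covered_byI by metis
  let ?N = "insert m (N - {n})"
  have "w \<notin> covered_by G (N - {n})" 
    using matching_unique[OF mN _ n(1) _ n(2)] unfolding covered_by_iff by blast
  moreover have "covered_by G (N - {n}) \<subseteq> ?CN" by (intro covered_by_mono) auto
  ultimately have "ends G m \<inter> covered_by G (N - {n}) = {}" using w y by auto
  then have mN': "matching G ?N"
    by (intro matching_insert mE matching_subset[OF mN]) auto
  have cN': "card ?N = card N" using mnN n(1) fN by (simp add: card_Suc_Diff1 del: card_Diff_insert)
  have "maximum_matching G ?N" using N mN' cN' unfolding maximum_matching_def by simp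
  moreover have "t \<notin> covered_by G ?N"
    using N w y \<open>w \<in> ?CN\<close> covered_by_mono[of "N - {n}" N G]
    unfolding covered_by_insert by auto
  ultimately have "card (M \<inter> ?N) \<le> card (M \<inter> N)" using Nmax by blast
  moreover have "M \<inter> N \<subset> M \<inter> ?N" using m mnN nM by blast
  ultimately show False using fM psubset_card_mono[of "M \<inter> ?N" "M \<inter> N"] by simp
qed


text \<open>The members of \<open>\<P>\<close> play the role of the odd components of \<open>G - S\<close>. Only parity and the absence
of edges between them enter the counting, so they may be disconnected.\<close>

definition barrier_family :: "('v, 'e) multigraph \<Rightarrow> 'v set \<Rightarrow> 'v set set \<Rightarrow> bool" where
  "barrier_family G S \<P> \<longleftrightarrow>
     S \<subseteq> vertices G \<and>
     (\<forall>P\<in>\<P>. P \<subseteq> vertices G - S \<and> odd (card P)) \<and>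
     (\<forall>P\<in>\<P>. \<forall>Q\<in>\<P>. P \<noteq> Q \<longrightarrow> P \<inter> Q = {}) \<and>
     (\<forall>P\<in>\<P>. \<forall>e\<in>edges G. ends G e \<inter> P \<noteq> {} \<longrightarrow> ends G e \<subseteq> P \<union> S)"

text \<open>By Gallai's exchange, being equal or never both missed by a maximum matching is an equivalence relation
that relates the two ends of every edge. A maximum matching misses at most one vertex of each class
and matches the remaining ones inside the class, so the classes with a missed vertex are odd, and
their number is the deficiency.\<close>

lemma berge_without_essential_vertex:
  assumes G: "loopless_multigraph G"
    and ess: "\<And>t. t \<in> vertices G \<Longrightarrow> \<exists>N. maximum_matching G N \<and> t \<notin> covered_by G N"
  shows "\<exists>\<P> M. matching G M \<and> barrier_family G {} \<P> \<and> card \<P> + 2 * card M = card (vertices G)"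
proof -
  have fV: "finite (vertices G)" using G unfolding loopless_multigraph_def by auto
  define R where "R a b \<longleftrightarrow> a = b \<or>
      (\<forall>M. maximum_matching G M \<longrightarrow> a \<in> covered_by G M \<or> b \<in> covered_by G M)" for a b
  have Rsym: "R a b \<Longrightarrow> R b a" for a b unfolding R_def by blast
  have Rtrans: "R a c" if "a \<in> vertices G" "b \<in> vertices G" "c \<in> vertices G" "R a b" "R b c" for a b c
  proof (rule ccontr)
    assume n: "\<not> R a c"
    then obtain M where M: "maximum_matching G M" "a \<notin> covered_by G M" "c \<notin> covered_by G M" "a \<noteq> c"
      unfolding R_def by blast
    then have ne: "a \<noteq> b" "b \<noteq> c" using n that by auto
    have b: "b \<in> covered_by G M" using M ne that unfolding R_def by blast
    obtain N0 where "maximum_matching G N0" "b \<notin> covered_by G N0"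
      using ess[OF \<open>b \<in> vertices G\<close>] by blast
    moreover have "\<And>N. maximum_matching G N \<Longrightarrow> b \<notin> covered_by G N \<Longrightarrow>
                a \<in> covered_by G N \<and> c \<in> covered_by G N"
      using that ne unfolding R_def by blast
    ultimately show False
      using gallai_exchange[OF G M(1) that(1,3) M(4,2,3) b] by blast
  qed
  have Redge: "R a b" if "e \<in> edges G" "a \<in> ends G e" "b \<in> ends G e" for a b e
  proof (rule ccontr)
    assume n: "\<not> R a b"
    then obtain M where M: "maximum_matching G M" "a \<notin> covered_by G M" "b \<notin> covered_by G M" "a \<noteq> b"
      unfolding R_def by blast
    have "ends G e = {a, b}" using edge_ends_eq[OF G that M(4)] .
    then show False using maximum_matching_misses_no_edge[OF G M(1) that(1)] M(2,3) by simp
  qed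
  obtain M where M: "maximum_matching G M" using maximum_matching_exists[OF G] .
  have mM: "matching G M" using M unfolding maximum_matching_def by auto
  let ?U = "vertices G - covered_by G M"
  let ?C = "\<lambda>u. {w \<in> vertices G. R u w}"
  have Ueq: "u = u'" if "u \<in> ?U" "u' \<in> ?U" "R u u'" for u u'
    using that M unfolding R_def by blast
  have disj: "?C u \<inter> ?C u' = {}" if "u \<in> ?U" "u' \<in> ?U" "u \<noteq> u'" for u u'
    using that Ueq Rtrans Rsym by blast
  have inj: "inj_on ?C ?U"
  proof (rule inj_onI, rule ccontr)
    fix u u' assume a: "u \<in> ?U" "u' \<in> ?U" "?C u = ?C u'" "u \<noteq> u'"
    then have "u \<in> ?C u" unfolding R_def by auto
    then show False using disj[OF a(1,2,4)] a(3) by blast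
  qed
  have odd: "odd (card (?C u))" if u: "u \<in> ?U" for u
  proof -
    let ?N = "{e \<in> M. ends G e \<subseteq> ?C u}"
    have mN: "matching G ?N" by (rule matching_subset[OF mM]) auto
    have "?C u - {u} = covered_by G ?N"
    proof
      have "u \<notin> covered_by G ?N" using u covered_by_mono[of ?N M G] by auto
      then show "covered_by G ?N \<subseteq> ?C u - {u}" by (auto simp: covered_by_iff)
      show "?C u - {u} \<subseteq> covered_by G ?N"
      proof
        fix w assume w: "w \<in> ?C u - {u}"
        then have "w \<in> covered_by G M" using Ueq[OF u, of w] by blast
        then obtain e where e: "e \<in> M" "w \<in> ends G e" unfolding covered_by_iff by blast
        have eE: "e \<in> edges G" using e mM unfolding matching_def by auto
        have "ends G e \<subseteq> vertices G" using G eE unfolding loopless_multigraph_def by auto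
        moreover have "R u z" if "z \<in> ends G e" for z
          using Rtrans[of u w z] Redge[OF eE e(2) that] w u that calculation by blast
        ultimately have "ends G e \<subseteq> ?C u" by blast
        then show "w \<in> covered_by G ?N" using e by (intro covered_byI) auto
      qed
    qed
    then have "card (?C u - {u}) = 2 * card ?N" using card_covered_by[OF G mN] by simp
    moreover have "u \<in> ?C u" using u unfolding R_def by auto
    then have "card (?C u) = Suc (card (?C u - {u}))"
      using fV card_Suc_Diff1[of "?C u" u] by simp
    ultimately show ?thesis by simp
  qed
  have "barrier_family G {} (?C ` ?U)"
    unfolding barrier_family_def
  proof (intro conjI ballI impI)
    fix P e assume P: "P \<in> ?C ` ?U" and e: "e \<in> edges G" "ends G e \<inter> P \<noteq> {}"
    then obtain u w where u: "u \<in> ?U" "P = ?C u" and w: "w \<in> ends G e" "w \<in> ?C u" by blast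
    have sub: "ends G e \<subseteq> vertices G" using G e unfolding loopless_multigraph_def by auto
    have "R u z" if "z \<in> ends G e" for z
      using Rtrans[of u w z] Redge[OF e(1) w(1) that] w u that sub by blast
    then show "ends G e \<subseteq> P \<union> {}" using sub u by blast
  next
    fix P Q assume PQ: "P \<in> ?C ` ?U" "Q \<in> ?C ` ?U" "P \<noteq> Q"
    obtain u where u: "u \<in> ?U" "P = ?C u" using PQ(1) by (rule imageE)
    obtain u' where u': "u' \<in> ?U" "Q = ?C u'" using PQ(2) by (rule imageE)
    have "u \<noteq> u'" using PQ(3) u u' by metis
    then show "P \<inter> Q = {}" using disj[OF u(1) u'(1)] u u' by simp
  next
    fix P assume "P \<in> ?C ` ?U"
    then obtain u where u: "u \<in> ?U" "P = ?C u" by (rule imageE)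
    show "odd (card P)" unfolding u(2) by (rule odd[OF u(1)])
  qed auto
  moreover have "card (?C ` ?U) + 2 * card M = card (vertices G)"
  proof -
    have "card (?C ` ?U) = card ?U" using inj by (rule card_image)
    also have "\<dots> = card (vertices G) - card (covered_by G M)"
      using covered_by_subset[OF G mM] by (simp add: card_Diff_subset)
    also have "card (covered_by G M) = 2 * card M" by (rule card_covered_by[OF G mM])
    finally have "card (?C ` ?U) = card (vertices G) - 2 * card M" .
    moreover have "2 * card M \<le> card (vertices G)"
      using card_mono[OF fV covered_by_subset(1)[OF G mM]] card_covered_by[OF G mM] by simp
    ultimately show ?thesis by linarith
  qed
  ultimately show ?thesis using mM by blast
qed

text \<open>The nontrivial half of the Tutte--Berge formula. A vertex \<open>v\<close> covered by all maximum matchings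
can be moved into \<open>S\<close>: without it the matching number drops by one, and the deficiency grows by one.\<close>

lemma berge:
  assumes "loopless_multigraph G"
  shows "\<exists>S \<P> M. matching G M \<and> barrier_family G S \<P> \<and>
           card \<P> + 2 * card M = card (vertices G) + card S"
  using assms
proof (induction "card (vertices G)" arbitrary: G rule: less_induct)
  case less
  note G = less.prems
  have fV: "finite (vertices G)" using G unfolding loopless_multigraph_def by auto
  show ?case
  proof (cases "\<exists>v\<in>vertices G. \<forall>N. maximum_matching G N \<longrightarrow> v \<in> covered_by G N")
    case False
    then show ?thesis using berge_without_essential_vertex[OF G]
      by (metis (no_types, lifting) add_0_right card.empty)
  next
    case True
    then obtain v where v: "v \<in> vertices G"
      and ess: "\<And>N. maximum_matching G N \<Longrightarrow> v \<in> covered_by G N" by blast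
    let ?G = "G\<lparr>vertices := vertices G - {v}, edges := {e \<in> edges G. v \<notin> ends G e}\<rparr>"
    have G': "loopless_multigraph ?G" using G unfolding loopless_multigraph_def by auto
    have c: "card (vertices G) = Suc (card (vertices ?G))" using card_Suc_Diff1[OF fV v] by simp
    obtain S \<P> M where M: "matching ?G M" and bf: "barrier_family ?G S \<P>"
      and eq: "card \<P> + 2 * card M = card (vertices ?G) + card S"
      using less.hyps[OF _ G'] c by auto
    have mM: "matching G M" using M unfolding matching_def by auto
    have "v \<notin> covered_by G M" using M unfolding matching_def covered_by_iff by auto
    then have nm: "\<not> maximum_matching G M" using ess by blast
    obtain N where N: "maximum_matching G N" using maximum_matching_exists[OF G] .
    have "card M < card N" using nm N mM unfolding maximum_matching_def
      by (meson le_trans not_le)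
    then obtain N' where N': "N' \<subseteq> N" "card N' = Suc (card M)"
      by (meson Suc_leI obtain_subset_with_card_n)
    have mN': "matching G N'" using N N' matching_subset unfolding maximum_matching_def by blast
    have vS: "v \<notin> S" and fS: "finite S" using bf fV unfolding barrier_family_def
      by (auto intro: finite_subset)
    have "barrier_family G (insert v S) \<P>"
    proof -
      have "ends G e \<subseteq> P \<union> insert v S"
        if P: "P \<in> \<P>" and e: "e \<in> edges G" "ends G e \<inter> P \<noteq> {}" for P e
      proof (cases "v \<in> ends G e")
        case True
        obtain w where w: "ends G e = {v, w}" using edge_ends_two[OF G e(1) True] by metis
        have "v \<notin> P" using bf P unfolding barrier_family_def by auto
        then show ?thesis using w e by auto
      next
        case False
        then have "e \<in> edges ?G" using e by simp
        then have "ends ?G e \<subseteq> P \<union> S" using bf P e(2) unfolding barrier_family_def by simp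
        then show ?thesis by auto
      qed
      then show ?thesis using bf v unfolding barrier_family_def by auto
    qed
    moreover have "card \<P> + 2 * card N' = card (vertices G) + card (insert v S)"
      using eq c N' vS fS by simp
    ultimately show ?thesis using mN' by blast
  qed
qed

section \<open>Perfect matchings, dependence and tight cuts\<close>

definition edge_cut :: "('v, 'e) multigraph \<Rightarrow> 'v set \<Rightarrow> 'e set" where
  "edge_cut G X = {e \<in> edges G. ends G e \<inter> X \<noteq> {} \<and> \<not> ends G e \<subseteq> X}"

text \<open>Connectedness is stated by cuts since this form passes to contractions at once.\<close>

definition cut_connected :: "('v, 'e) multigraph \<Rightarrow> bool" where
  "cut_connected G \<longleftrightarrow> (\<forall>X. X \<subseteq> vertices G \<longrightarrow> X \<noteq> {} \<longrightarrow> X \<noteq> vertices G \<longrightarrow> edge_cut G X \<noteq> {})"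

definition depends_on :: "('v, 'e) multigraph \<Rightarrow> 'e \<Rightarrow> 'e \<Rightarrow> bool" where
  "depends_on G f e \<longleftrightarrow> (\<forall>M. perfect_matching G M \<longrightarrow> f \<in> M \<longrightarrow> e \<in> M)"

definition solo :: "('v, 'e) multigraph \<Rightarrow> 'e \<Rightarrow> bool" where
  "solo G e \<longleftrightarrow> e \<in> edges G \<and> (\<forall>f\<in>edges G. depends_on G f e \<longrightarrow> f = e)"

definition all_admissible :: "('v, 'e) multigraph \<Rightarrow> bool" where
  "all_admissible G \<longleftrightarrow> (\<forall>e\<in>edges G. \<exists>M. perfect_matching G M \<and> e \<in> M)"

lemma edge_ends_subset:
  "loopless_multigraph G \<Longrightarrow> e \<in> edges G \<Longrightarrow> ends G e \<subseteq> vertices G"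
  unfolding loopless_multigraph_def by auto

lemma edge_ends_nonempty:
  "loopless_multigraph G \<Longrightarrow> e \<in> edges G \<Longrightarrow> ends G e \<noteq> {}"
  unfolding loopless_multigraph_def by fastforce

lemma loopless_finite:
  "loopless_multigraph G \<Longrightarrow> finite (vertices G)"
  "loopless_multigraph G \<Longrightarrow> finite (edges G)"
  unfolding loopless_multigraph_def by auto

lemma perfect_matching_iff:
  assumes G: "loopless_multigraph G"
  shows "perfect_matching G M \<longleftrightarrow>
    M \<subseteq> edges G \<and> (\<forall>v\<in>vertices G. \<exists>!e. e \<in> M \<and> v \<in> ends G e)"
proof
  assume "perfect_matching G M"
  then have m: "matching G M" and c: "\<And>v. v \<in> vertices G \<Longrightarrow> \<exists>e\<in>M. v \<in> ends G e"
    unfolding perfect_matching_def by auto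
  show "M \<subseteq> edges G \<and> (\<forall>v\<in>vertices G. \<exists>!e. e \<in> M \<and> v \<in> ends G e)"
    using m c matching_unique[OF m] matching_finite(2)[OF G m] by (metis)
next
  assume a: "M \<subseteq> edges G \<and> (\<forall>v\<in>vertices G. \<exists>!e. e \<in> M \<and> v \<in> ends G e)"
  have "ends G e \<inter> ends G f = {}" if "e \<in> M" "f \<in> M" "e \<noteq> f" for e f
  proof (rule ccontr)
    assume "ends G e \<inter> ends G f \<noteq> {}"
    then obtain v where v: "v \<in> ends G e" "v \<in> ends G f" by auto
    then have "v \<in> vertices G" using edge_ends_subset[OF G] a that by blast
    then show False using a v that by blast
  qed
  then show "perfect_matching G M"
    using a unfolding perfect_matching_def matching_def by (simp add: Bex_def) blast
qed

lemma perfect_matching_unique: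
  "perfect_matching G M \<Longrightarrow> e \<in> M \<Longrightarrow> f \<in> M \<Longrightarrow> v \<in> ends G e \<Longrightarrow> v \<in> ends G f \<Longrightarrow> e = f"
  unfolding perfect_matching_def using matching_unique by metis

lemma perfect_matching_edges: "perfect_matching G M \<Longrightarrow> e \<in> M \<Longrightarrow> e \<in> edges G"
  unfolding perfect_matching_def matching_def by auto

lemma perfect_matching_covers:
  "perfect_matching G M \<Longrightarrow> v \<in> vertices G \<Longrightarrow> \<exists>e. e \<in> M \<and> v \<in> ends G e"
  unfolding perfect_matching_def by auto

lemma odd_set_meets_cut:
  assumes G: "loopless_multigraph G" and M: "perfect_matching G M"
    and X: "X \<subseteq> vertices G" "odd (card X)"
  shows "\<exists>e\<in>M. e \<in> edge_cut G X"
proof (rule ccontr)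
  assume n: "\<not> ?thesis"
  let ?N = "{e \<in> M. ends G e \<subseteq> X}"
  have mN: "matching G ?N" 
    using M matching_subset[of G M ?N] unfolding perfect_matching_def by simp
  have "X = covered_by G ?N"
  proof
    show "covered_by G ?N \<subseteq> X" by (auto simp: covered_by_iff)
    show "X \<subseteq> covered_by G ?N"
    proof
      fix v assume v: "v \<in> X"
      then obtain e where e: "e \<in> M" "v \<in> ends G e" using perfect_matching_covers[OF M] X by blast
      then have "ends G e \<subseteq> X"
        using n v perfect_matching_edges[OF M e(1)] unfolding edge_cut_def by blast
      then show "v \<in> covered_by G ?N" using e unfolding covered_by_iff by blast
    qed
  qed
  then have "card X = 2 * card ?N" using card_covered_by[OF G mN] by simp
  then show False using X by simp
qed

lemma edge_cut_complement:
  assumes "loopless_multigraph G"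
  shows "edge_cut G (vertices G - X) = edge_cut G X"
  using edge_ends_subset[OF assms] unfolding edge_cut_def by blast

definition contract :: "('v, 'e) multigraph \<Rightarrow> 'v set \<Rightarrow> 'v \<Rightarrow> ('v, 'e) multigraph" where
  "contract G X r = G\<lparr>vertices := insert r (vertices G - X),
     edges := {e \<in> edges G. \<not> ends G e \<subseteq> X},
     ends := \<lambda>e. (\<lambda>v. if v \<in> X then r else v) ` ends G e\<rparr>"

lemma contract_simps:
  "vertices (contract G X r) = insert r (vertices G - X)"
  "edges (contract G X r) = {e \<in> edges G. \<not> ends G e \<subseteq> X}"
  unfolding contract_def by simp_all

lemma contract_ends_other: "r \<in> X \<Longrightarrow> v \<notin> X \<Longrightarrow> v \<in> ends (contract G X r) e \<longleftrightarrow> v \<in> ends G e"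
  unfolding contract_def by auto

lemma contract_ends_new: "r \<in> X \<Longrightarrow> r \<in> ends (contract G X r) e \<longleftrightarrow> ends G e \<inter> X \<noteq> {}"
  unfolding contract_def by auto

lemma contract_loopless:
  assumes G: "loopless_multigraph G" and X: "X \<subseteq> vertices G" "r \<in> X"
  shows "loopless_multigraph (contract G X r)"
proof -
  have "card (ends (contract G X r) e) = 2 \<and> ends (contract G X r) e \<subseteq> insert r (vertices G - X)"
    if e: "e \<in> edges G" "\<not> ends G e \<subseteq> X" for e
  proof -
    obtain b where b: "b \<in> ends G e" "b \<notin> X" using e by blast
    obtain a where a: "ends G e = {b, a}" "b \<noteq> a" "a \<in> vertices G" "b \<in> vertices G"
      using edge_ends_two[OF G e(1) b(1)] by metis
    have "ends (contract G X r) e = {b, if a \<in> X then r else a}"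
      using a b unfolding contract_def by auto
    then show ?thesis using a b X by (auto simp: card_insert_if)
  qed
  then show ?thesis
    using loopless_finite[OF G] unfolding loopless_multigraph_def contract_simps by auto
qed

definition tight_cut :: "('v, 'e) multigraph \<Rightarrow> 'v set \<Rightarrow> bool" where
  "tight_cut G X \<longleftrightarrow> (\<forall>M. perfect_matching G M \<longrightarrow> (\<exists>!c. c \<in> M \<and> c \<in> edge_cut G X))"

text \<open>Both shores \<open>X\<close> and \<open>vertices G - X\<close> of a tight cut are contracted, to the representatives \<open>r\<close> and \<open>s\<close>.
Edges keep their names, so that perfect matchings of the contractions are obtained from those of \<open>G\<close> by
intersection, and two of them that agree on the cut are glued by union.\<close>

locale tight_split =
  fixes G :: "('v, 'e) multigraph" and X :: "'v set" and r s :: 'v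
  assumes loopless: "loopless_multigraph G"
    and admissible: "all_admissible G"
    and conn: "cut_connected G"
    and shore: "X \<subseteq> vertices G" "r \<in> X" "s \<in> vertices G - X"
    and tight: "tight_cut G X"
begin

abbreviation "G1 \<equiv> contract G X r"
abbreviation "G2 \<equiv> contract G (vertices G - X) s"

lemma swap: "tight_split G (vertices G - X) s r"
proof
  show "tight_cut G (vertices G - X)"
    using tight edge_cut_complement[OF loopless] unfolding tight_cut_def by simp
qed (use loopless admissible conn shore in auto)

lemma loopless1: "loopless_multigraph G1"
  using contract_loopless[OF loopless] shore by blast

lemma loopless2: "loopless_multigraph G2"
  using tight_split.loopless1[OF swap] .

lemma cut_iff1: "e \<in> edges G1 \<Longrightarrow> e \<in> edge_cut G X \<longleftrightarrow> r \<in> ends G1 e"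
  using contract_ends_new[OF shore(2), of G e] unfolding edge_cut_def contract_simps by auto

lemma cut_iff: "e \<in> edge_cut G X \<longleftrightarrow> e \<in> edges G1 \<and> e \<in> edges G2"
  using edge_ends_subset[OF loopless] unfolding edge_cut_def contract_simps by auto

lemma edges_cases: "e \<in> edges G \<Longrightarrow> e \<in> edges G1 \<or> e \<in> edges G2"
  using edge_ends_subset[OF loopless, of e] edge_ends_nonempty[OF loopless, of e]
  unfolding contract_simps by auto

lemma restrict1:
  assumes M: "perfect_matching G M"
  shows "perfect_matching G1 (M \<inter> edges G1)"
  unfolding perfect_matching_iff[OF loopless1]
proof (intro conjI ballI)
  fix v assume v: "v \<in> vertices G1"
  show "\<exists>!e. e \<in> M \<inter> edges G1 \<and> v \<in> ends G1 e"
  proof (cases "v = r")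
    case True
    have "e \<in> M \<inter> edges G1 \<and> v \<in> ends G1 e \<longleftrightarrow> e \<in> M \<and> e \<in> edge_cut G X" for e
      using cut_iff1[of e] cut_iff[of e] True by auto
    then show ?thesis using tight M unfolding tight_cut_def by simp
  next
    case False
    then have v: "v \<in> vertices G" "v \<notin> X" using v unfolding contract_simps by auto
    have "e \<in> M \<inter> edges G1 \<and> v \<in> ends G1 e \<longleftrightarrow> e \<in> M \<and> v \<in> ends G e" for e
      using contract_ends_other[OF shore(2) v(2), of G e] v(2) perfect_matching_edges[OF M, of e]
      unfolding contract_simps by auto
    then show ?thesis using M v unfolding perfect_matching_iff[OF loopless] by simp
  qed
qed auto

lemma restrict2:
  "perfect_matching G M \<Longrightarrow> perfect_matching G2 (M \<inter> edges G2)"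
  using tight_split.restrict1[OF swap] .

lemma cut_edge1:
  assumes "perfect_matching G1 M"
  shows "\<exists>!c. c \<in> M \<and> c \<in> edge_cut G X"
proof -
  have eq: "e \<in> M \<and> r \<in> ends G1 e \<longleftrightarrow> e \<in> M \<and> e \<in> edge_cut G X" for e
    using cut_iff1[of e] perfect_matching_edges[OF assms] by auto
  have "r \<in> vertices G1" unfolding contract_simps by simp
  then have "\<exists>!e. e \<in> M \<and> r \<in> ends G1 e"
    using assms unfolding perfect_matching_iff[OF loopless1] by simp
  then show ?thesis by (simp only: eq)
qed

lemma cut_edge2:
  assumes "perfect_matching G2 M"
  shows "\<exists>!c. c \<in> M \<and> c \<in> edge_cut G X"
  using tight_split.cut_edge1[OF swap assms] edge_cut_complement[OF loopless] by simp

lemma glue_covers1: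
  assumes M1: "perfect_matching G1 M1" and M2: "perfect_matching G2 M2"
    and c: "c \<in> M1" "c \<in> M2" "c \<in> edge_cut G X"
    and v: "v \<in> vertices G" "v \<notin> X"
  shows "\<exists>!e. e \<in> M1 \<union> M2 \<and> v \<in> ends G e"
proof -
  have eq: "e \<in> M1 \<union> M2 \<and> v \<in> ends G e \<longleftrightarrow> e \<in> M1 \<and> v \<in> ends G1 e" for e
  proof -
    have "e = c" if "e \<in> M2" "v \<in> ends G e"
    proof -
      have "e \<in> edges G2" using perfect_matching_edges[OF M2 that(1)] .
      then have "e \<in> edge_cut G X" using that(2) v edge_ends_subset[OF loopless, of e]
        unfolding edge_cut_def contract_simps by auto
      then show ?thesis using cut_edge2[OF M2] c that by blast
    qed
    then show ?thesis using contract_ends_other[OF shore(2) v(2), of G e] c by auto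
  qed
  have "v \<in> vertices G1" using v unfolding contract_simps by auto
  then have "\<exists>!e. e \<in> M1 \<and> v \<in> ends G1 e"
    using M1 unfolding perfect_matching_iff[OF loopless1] by simp
  then show ?thesis by (simp only: eq)
qed

lemma glue:
  assumes M1: "perfect_matching G1 M1" and M2: "perfect_matching G2 M2"
    and c: "c \<in> M1" "c \<in> M2" "c \<in> edge_cut G X"
  shows "perfect_matching G (M1 \<union> M2)"
    and "(M1 \<union> M2) \<inter> edges G1 = M1"
    and "(M1 \<union> M2) \<inter> edges G2 = M2"
proof -
  have e: "M1 \<subseteq> edges G1" "M2 \<subseteq> edges G2"
    using perfect_matching_edges[OF M1] perfect_matching_edges[OF M2] by auto
  have u1: "e = c" if "e \<in> M1" "e \<in> edges G2" for e
    using cut_edge1[OF M1] c that e cut_iff[of e] by blast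
  have u2: "e = c" if "e \<in> M2" "e \<in> edges G1" for e
    using cut_edge2[OF M2] c that e cut_iff[of e] by blast
  show "(M1 \<union> M2) \<inter> edges G1 = M1" using e u2 c by auto
  show "(M1 \<union> M2) \<inter> edges G2 = M2" using e u1 c by auto
  show "perfect_matching G (M1 \<union> M2)"
    unfolding perfect_matching_iff[OF loopless]
  proof (intro conjI ballI)
    show "M1 \<union> M2 \<subseteq> edges G" using e unfolding contract_simps by auto
    fix v assume v: "v \<in> vertices G"
    show "\<exists>!e. e \<in> M1 \<union> M2 \<and> v \<in> ends G e"
    proof (cases "v \<in> X")
      case False
      then show ?thesis using glue_covers1[OF M1 M2 c v] by simp
    next
      case True
      have d: "vertices G - (vertices G - X) = X" using shore by auto
      have "\<exists>!e. e \<in> M2 \<union> M1 \<and> v \<in> ends G e"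
        by (rule tight_split.glue_covers1[OF swap, of M2 M1 c v])
          (use M1 M2 c v True in \<open>simp_all add: d edge_cut_complement[OF loopless]\<close>)
      then show ?thesis by (simp add: Un_commute)
    qed
  qed
qed

lemma extend1:
  assumes M1: "perfect_matching G1 M1"
  shows "\<exists>M. perfect_matching G M \<and> M \<inter> edges G1 = M1"
proof -
  obtain c where c: "c \<in> M1" "c \<in> edge_cut G X" using cut_edge1[OF M1] by blast
  then have "c \<in> edges G" unfolding edge_cut_def by simp
  then obtain N where N: "perfect_matching G N" "c \<in> N"
    using admissible unfolding all_admissible_def by blast
  have "c \<in> N \<inter> edges G2" using c N cut_iff by auto
  then show ?thesis using glue[OF M1 restrict2[OF N(1)] c(1) _ c(2)] by blast
qed

lemma admissible1: "all_admissible G1"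
  unfolding all_admissible_def
proof
  fix e assume e: "e \<in> edges G1"
  then have "e \<in> edges G" unfolding contract_simps by simp
  then obtain N where N: "perfect_matching G N" "e \<in> N"
    using admissible unfolding all_admissible_def by blast
  then show "\<exists>M. perfect_matching G1 M \<and> e \<in> M" using restrict1[OF N(1)] e by blast
qed

lemma conn1: "cut_connected G1"
  unfolding cut_connected_def
proof (intro allI impI)
  fix Y assume Y: "Y \<subseteq> vertices G1" "Y \<noteq> {}" "Y \<noteq> vertices G1"
  define Z where "Z = {v \<in> vertices G. (if v \<in> X then r else v) \<in> Y}"
  have "Z \<noteq> {}"
  proof -
    obtain y where "y \<in> Y" using Y by auto
    then have "y \<in> Z" using Y(1) shore unfolding Z_def contract_simps by auto
    then show ?thesis by auto
  qed
  moreover have "Z \<noteq> vertices G"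
  proof -
    obtain y where y: "y \<in> vertices G1" "y \<notin> Y" using Y by auto
    then have "y \<in> vertices G" "y \<notin> Z" using shore unfolding Z_def contract_simps by auto
    then show ?thesis by auto
  qed
  moreover have "Z \<subseteq> vertices G" unfolding Z_def by auto
  ultimately obtain e where e: "e \<in> edge_cut G Z"
    using conn unfolding cut_connected_def by blast
  then obtain a b where ab: "e \<in> edges G" "a \<in> ends G e" "a \<in> Z" "b \<in> ends G e" "b \<notin> Z"
    unfolding edge_cut_def by blast
  have bV: "b \<in> vertices G" using edge_ends_subset[OF loopless] ab by blast
  let ?c = "\<lambda>v. if v \<in> X then r else v"
  have c: "?c a \<in> Y" "?c b \<notin> Y" using ab bV unfolding Z_def by auto
  moreover have "?c a \<in> ends G1 e" "?c b \<in> ends G1 e" using ab unfolding contract_def by auto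
  moreover have "e \<in> edges G1" using ab c unfolding contract_simps by (auto split: if_splits)
  ultimately show "edge_cut G1 Y \<noteq> {}" unfolding edge_cut_def by blast
qed

text \<open>Dependence on an edge that survives the contraction is the same in \<open>G\<close> and in \<open>G1\<close>, because perfect
matchings restrict and extend; this and the next lemma are the two directions.\<close>

lemma depends1:
  assumes "depends_on G f e" "e \<in> edges G1"  
  shows "depends_on G1 f e"
  unfolding depends_on_def
proof (intro allI impI)
  fix M1 assume M1: "perfect_matching G1 M1" "f \<in> M1"
  then obtain M where M: "perfect_matching G M" "M \<inter> edges G1 = M1" using extend1 by blast
  then have "e \<in> M" using assms M1 unfolding depends_on_def by blast
  then show "e \<in> M1" using assms(2) M(2) by blast
qed

lemma depends_lift1:
  assumes "depends_on G1 f e" "f \<in> edges G1"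
  shows "depends_on G f e"
  unfolding depends_on_def
proof (intro allI impI)
  fix M assume M: "perfect_matching G M" "f \<in> M"
  then have "e \<in> M \<inter> edges G1"
    using restrict1[OF M(1)] assms unfolding depends_on_def by blast
  then show "e \<in> M" by blast
qed

text \<open>Given \<open>f \<noteq> h\<close>, a perfect matching through \<open>f\<close> that avoids \<open>h\<close> is glued from one of each contraction.
On the side that does not contain \<open>f\<close> it is prescribed only which cut edge \<open>c\<close> is used, and solo edges
can be avoided there because \<open>c \<noteq> h\<close>.\<close>

lemma solo_glue:
  assumes h: "h \<in> edges G1" "solo G1 h" and h2: "h \<in> edges G2 \<Longrightarrow> solo G2 h"
  shows "solo G h"
proof -
  have "f = h" if f: "f \<in> edges G" "depends_on G f h" for f
  proof (rule ccontr)
    assume fh: "f \<noteq> h"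
    show False
    proof (cases "f \<in> edges G1")
      case True
      then show False using depends1[OF f(2) h(1)] h(2) fh unfolding solo_def by blast
    next
      case False
      then have f2: "f \<in> edges G2" using edges_cases f by blast
      have "\<exists>M2. perfect_matching G2 M2 \<and> f \<in> M2 \<and> h \<notin> M2"
      proof (cases "h \<in> edges G2")
        case True
        then show ?thesis using h2 f2 fh unfolding solo_def depends_on_def by blast
      next
        case False
        obtain N where N: "perfect_matching G N" "f \<in> N"
          using admissible f unfolding all_admissible_def by blast
        then show ?thesis using restrict2[OF N(1)] False f2 by blast
      qed
      then obtain M2 where M2: "perfect_matching G2 M2" "f \<in> M2" "h \<notin> M2" by blast
      obtain c where c: "c \<in> M2" "c \<in> edge_cut G X" using cut_edge2[OF M2(1)] by blast
      have "c \<noteq> h" "c \<in> edges G1" using c M2 cut_iff by auto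
      then obtain M1 where M1: "perfect_matching G1 M1" "c \<in> M1" "h \<notin> M1"
        using h(2) unfolding solo_def depends_on_def by blast
      have "perfect_matching G (M1 \<union> M2)" using glue(1)[OF M1(1) M2(1) M1(2) c] .
      then show False using f(2) M1 M2 unfolding depends_on_def by blast
    qed
  qed
  then show ?thesis using h(1) unfolding solo_def contract_simps by blast
qed

end

section \<open>The barrier of two mutually dependent edges\<close>

text \<open>The structure forced by two edges \<open>e\<close> and \<open>f\<close> that lie in the same perfect matchings: up to \<open>e\<close> and \<open>f\<close>
the graph is bipartite between \<open>B\<close> and the contracted members of \<open>\<P>\<close>.\<close>

definition dependence_barrier ::
    "('v, 'e) multigraph \<Rightarrow> 'e \<Rightarrow> 'e \<Rightarrow> 'v set \<Rightarrow> 'v set set \<Rightarrow> bool" where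
  "dependence_barrier G e f B \<P> \<longleftrightarrow>
     ends G f \<subseteq> B \<and> B \<inter> \<Union>\<P> = {} \<and> vertices G = B \<union> \<Union>\<P> \<and> card \<P> = card B \<and>
     (\<forall>P\<in>\<P>. odd (card P) \<and> tight_cut G P \<and> \<not> ends G e \<subseteq> P) \<and>
     (\<forall>P\<in>\<P>. \<forall>Q\<in>\<P>. P \<noteq> Q \<longrightarrow> P \<inter> Q = {}) \<and>
     ends G e \<subseteq> \<Union>\<P> \<and>
     (\<forall>P\<in>\<P>. \<forall>g\<in>edges G. g \<noteq> e \<longrightarrow> ends G g \<inter> P \<noteq> {} \<longrightarrow> ends G g \<subseteq> P \<union> B) \<and>
     (\<forall>g\<in>edges G. ends G g \<subseteq> B \<longrightarrow> g = f)"

text \<open>Without \<open>e\<close> and the ends of \<open>f\<close> there is no perfect matching: adding \<open>f\<close> would give one of \<open>G\<close> that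
contains \<open>f\<close> but not \<open>e\<close>. By parity the deficiency is at least 2.\<close>

lemma dependence_deficiency:
  assumes G: "loopless_multigraph G"
    and ef: "e \<noteq> f" "f \<in> edges G" "depends_on G f e"
    and M0: "perfect_matching G M0"
  shows "\<exists>S \<P>. S \<subseteq> vertices G - ends G f \<and> card \<P> \<ge> card S + 2 \<and>
     (\<forall>P\<in>\<P>. P \<subseteq> vertices G - (S \<union> ends G f) \<and> odd (card P)) \<and>
     (\<forall>P\<in>\<P>. \<forall>Q\<in>\<P>. P \<noteq> Q \<longrightarrow> P \<inter> Q = {}) \<and>
     (\<forall>P\<in>\<P>. \<forall>g\<in>edges G. g \<noteq> e \<longrightarrow> ends G g \<inter> P \<noteq> {} \<longrightarrow> ends G g \<subseteq> P \<union> (S \<union> ends G f))"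
proof -
  let ?W = "G\<lparr>vertices := vertices G - ends G f,
              edges := {g \<in> edges G. g \<noteq> e \<and> ends G g \<inter> ends G f = {}}\<rparr>"
  have fV: "finite (vertices G)" using loopless_finite[OF G] by simp
  have fs: "ends G f \<subseteq> vertices G" "card (ends G f) = 2"
    using G ef(2) unfolding loopless_multigraph_def by auto
  have W: "loopless_multigraph ?W" using G unfolding loopless_multigraph_def by auto
  obtain S \<P> M where M: "matching ?W M" and bf: "barrier_family ?W S \<P>"
      and eq: "card \<P> + 2 * card M = card (vertices ?W) + card S"
    using berge[OF W] by blast
  have mM: "matching G M" using M unfolding matching_def by auto
  have Mf: "M \<subseteq> {g \<in> edges G. g \<noteq> e \<and> ends G g \<inter> ends G f = {}}"
    using M unfolding matching_def by auto
  then have dj: "ends G f \<inter> covered_by G M = {}" unfolding covered_by_def by auto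
  have sub: "covered_by G M \<subseteq> vertices G - ends G f"
    using dj covered_by_subset[OF G mM] by auto
  have "covered_by G M \<noteq> vertices G - ends G f"
  proof
    assume c: "covered_by G M = vertices G - ends G f"
    have "matching G (insert f M)" by (rule matching_insert[OF mM ef(2) dj])
    moreover have "\<exists>g\<in>insert f M. v \<in> ends G g" if "v \<in> vertices G" for v
      using c that unfolding covered_by_def by auto
    ultimately have "perfect_matching G (insert f M)" unfolding perfect_matching_def by simp
    then have "e \<in> insert f M" using ef(3) unfolding depends_on_def by blast
    then show False using Mf ef(1) by auto
  qed
  then have "card (covered_by G M) < card (vertices G - ends G f)"
    using sub fV by (intro psubset_card_mono) auto
  then have lt: "2 * card M < card (vertices ?W)" using card_covered_by[OF G mM] by simp
  have m0: "matching G M0" using M0 unfolding perfect_matching_def by simp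
  have "covered_by G M0 = vertices G"
    using covered_by_subset(1)[OF G m0] M0 unfolding perfect_matching_def covered_by_def by auto
  then have "card (vertices G) = 2 * card M0" using card_covered_by[OF G m0] by simp
  moreover have "card (vertices ?W) = card (vertices G) - 2"
    using card_Diff_subset[OF finite_subset[OF fs(1) fV] fs(1)] fs(2) by simp
  ultimately have "card (vertices ?W) = 2 * (card M0 - 1)" by simp
  then have "2 * card M + 2 \<le> card (vertices ?W)" using lt by presburger
  then have card: "card \<P> \<ge> card S + 2" using eq by linarith
  have S: "S \<subseteq> vertices G - ends G f" using bf unfolding barrier_family_def by simp
  have P: "\<forall>P\<in>\<P>. P \<subseteq> vertices G - (S \<union> ends G f) \<and> odd (card P)"
    using bf unfolding barrier_family_def by auto
  have dis: "\<forall>P\<in>\<P>. \<forall>Q\<in>\<P>. P \<noteq> Q \<longrightarrow> P \<inter> Q = {}" using bf unfolding barrier_family_def by auto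
  have "ends G g \<subseteq> P \<union> (S \<union> ends G f)"
    if g: "P \<in> \<P>" "g \<in> edges G" "g \<noteq> e" "ends G g \<inter> P \<noteq> {}" for P g
  proof (cases "ends G g \<inter> ends G f = {}")
    case True
    then have "g \<in> edges ?W" using g by simp
    then have "ends ?W g \<subseteq> P \<union> S" using bf g unfolding barrier_family_def by simp
    then show ?thesis by auto
  next
    case False
    then obtain v where v: "v \<in> ends G g" "v \<in> ends G f" by auto
    obtain w where w: "w \<in> ends G g" "w \<in> P" using g by auto
    have "v \<noteq> w" using P g(1) v w by blast
    then have "ends G g = {v, w}" using edge_ends_eq[OF G g(2)] v w by metis
    then show ?thesis using v w by auto
  qed
  then show ?thesis using S card P dis by (intro exI[of _ S] exI[of _ \<P>] conjI) simp_all
qed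

lemma disjoint_family_hits_edge:
  assumes dis: "\<forall>P\<in>\<P>. \<forall>Q\<in>\<P>. P \<noteq> Q \<longrightarrow> P \<inter> Q = {}"
    and fin: "finite \<P>" and A: "card A = 2"
  shows "card {P \<in> \<P>. A \<inter> P \<noteq> {}} \<le> 2"
proof -
  have fA: "finite A" using A by (metis card.infinite zero_neq_numeral)
  define h where "h P = (SOME a. a \<in> A \<inter> P)" for P
  have h: "h P \<in> A \<inter> P" if "A \<inter> P \<noteq> {}" for P
    unfolding h_def using that by (metis ex_in_conv someI_ex)
  have "inj_on h {P \<in> \<P>. A \<inter> P \<noteq> {}}"
  proof (rule inj_onI)
    fix P Q assume PQ: "P \<in> {P \<in> \<P>. A \<inter> P \<noteq> {}}" "Q \<in> {P \<in> \<P>. A \<inter> P \<noteq> {}}" "h P = h Q"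
    then have "h P \<in> P \<inter> Q" using h[of P] h[of Q] by auto
    then show "P = Q" using dis PQ by blast
  qed
  moreover have "h ` {P \<in> \<P>. A \<inter> P \<noteq> {}} \<subseteq> A" using h by auto
  ultimately show ?thesis using card_inj_on_le[of h _ A] fA A by metis
qed

text \<open>A perfect matching \<open>N\<close> without \<open>e\<close> joins each of the odd sets to its own vertex of \<open>B\<close>, and there are at
least as many sets as vertices, so this is a bijection. If \<open>N\<close> contains \<open>e\<close>, then it contains \<open>f\<close> as well;
the same count applies to the sets that \<open>e\<close> does not meet, of which there are at least \<open>card B - 2\<close>, and
to the vertices of \<open>B\<close> that are not ends of \<open>f\<close>. In both cases no edge of \<open>N\<close> is left that could
enter one of the sets a second time, or join a vertex of \<open>B\<close> to anything outside the sets.\<close>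

lemma barrier_of_dependent_pair:
  assumes G: "loopless_multigraph G" and adm: "all_admissible G" and conn: "cut_connected G"
    and ef: "e \<noteq> f" "e \<in> edges G" "f \<in> edges G" "depends_on G f e" "depends_on G e f"
    and M0: "perfect_matching G M0" "e \<notin> M0"
  obtains B \<P> where "dependence_barrier G e f B \<P>"
proof -
  have fV: "finite (vertices G)" using loopless_finite[OF G] by simp
  have fs: "ends G f \<subseteq> vertices G" "card (ends G f) = 2"
    using G ef(3) unfolding loopless_multigraph_def by auto
  obtain S \<P> where S: "S \<subseteq> vertices G - ends G f" and cP: "card \<P> \<ge> card S + 2"
    and P0: "\<forall>P\<in>\<P>. P \<subseteq> vertices G - (S \<union> ends G f) \<and> odd (card P)"
    and dis: "\<forall>P\<in>\<P>. \<forall>Q\<in>\<P>. P \<noteq> Q \<longrightarrow> P \<inter> Q = {}"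
    and edg0: "\<forall>P\<in>\<P>. \<forall>g\<in>edges G. g \<noteq> e \<longrightarrow> ends G g \<inter> P \<noteq> {} \<longrightarrow> ends G g \<subseteq> P \<union> (S \<union> ends G f)"
    using dependence_deficiency[OF G ef(1,3,4) M0(1)] by (elim exE conjE) (rule that)
  define B where "B = S \<union> ends G f"
  have BV: "B \<subseteq> vertices G" and fB: "ends G f \<subseteq> B" using S fs unfolding B_def by auto
  have finB: "finite B" using BV fV finite_subset by blast
  have P: "P \<subseteq> vertices G - B" "odd (card P)" if "P \<in> \<P>" for P
    using P0 that unfolding B_def by auto
  have edg: "ends G g \<subseteq> P \<union> B" if "P \<in> \<P>" "g \<in> edges G" "g \<noteq> e" "ends G g \<inter> P \<noteq> {}" for P g
    using edg0 that unfolding B_def by auto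
  have cB: "card B = card S + 2"
    using S fs finite_subset[OF S] fV finite_subset[OF fs(1) fV]
    unfolding B_def by (subst card_Un_disjoint) auto
  have finP: "finite \<P>" using finite_subset[of \<P> "Pow (vertices G)"] P fV by auto
  have e2: "card (ends G e) = 2" using G ef(2) unfolding loopless_multigraph_def by auto
  \<comment> \<open>The sets and the vertices of the barrier that \<open>N\<close> does not serve by \<open>e\<close> and \<open>f\<close>.\<close>
  define \<Q> where "\<Q> N = {P \<in> \<P>. \<not> (e \<in> N \<and> ends G e \<inter> P \<noteq> {})}" for N
  define T where "T N = {b \<in> B. \<not> (e \<in> N \<and> b \<in> ends G f)}" for N
  have QP: "\<Q> N \<subseteq> \<P>" and TB: "T N \<subseteq> B" for N unfolding \<Q>_def T_def by auto
  have fN: "f \<in> N" if "perfect_matching G N" "e \<in> N" for N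
    using ef(5) that unfolding depends_on_def by simp
  have inT: "b \<in> T N"
    if "perfect_matching G N" "g \<in> N" "b \<in> ends G g" "b \<in> B" "g \<noteq> f" for b N g
    using perfect_matching_unique[OF that(1) that(2) fN[OF that(1)] that(3)] that(4,5)
    unfolding T_def by auto
  have cTQ: "card (T N) \<le> card (\<Q> N)" for N
  proof (cases "e \<in> N")
    case True
    have "T N = B - ends G f" using True unfolding T_def by auto
    then have 1: "card (T N) = card S"
      using cB fs(2) card_Diff_subset[OF finite_subset[OF fB finB] fB] by simp
    have "\<Q> N = \<P> - {P \<in> \<P>. ends G e \<inter> P \<noteq> {}}" using True unfolding \<Q>_def by auto
    then have "card (\<Q> N) = card \<P> - card {P \<in> \<P>. ends G e \<inter> P \<noteq> {}}"
      using finP card_Diff_subset[of "{P \<in> \<P>. ends G e \<inter> P \<noteq> {}}" \<P>] by simp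
    then show ?thesis using 1 cP disjoint_family_hits_edge[OF dis finP e2] by linarith
  next
    case False
    then have "T N = B" "\<Q> N = \<P>" unfolding T_def \<Q>_def by auto
    then show ?thesis using cP cB by simp
  qed
  have key: "\<exists>\<phi>. inj_on \<phi> (\<Q> N) \<and> \<phi> ` \<Q> N = T N \<and>
      (\<forall>P\<in>\<Q> N. \<exists>g\<in>N. \<phi> P \<in> ends G g \<and> ends G g \<inter> P \<noteq> {})" if N: "perfect_matching G N" for N
  proof -
    have "\<exists>b g. g \<in> N \<and> b \<in> T N \<and> b \<in> ends G g \<and> ends G g \<inter> P \<noteq> {}" if PQ: "P \<in> \<Q> N" for P
    proof -
      have PP: "P \<in> \<P>" using QP PQ by blast
      obtain g where g: "g \<in> N" "g \<in> edge_cut G P"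
        using odd_set_meets_cut[OF G N, of P] P[OF PP] by auto
      have gc: "g \<in> edges G" "ends G g \<inter> P \<noteq> {}" "\<not> ends G g \<subseteq> P"
        using g(2) unfolding edge_cut_def by auto
      have "g \<noteq> e" using PQ g gc unfolding \<Q>_def by auto
      then have "ends G g \<subseteq> P \<union> B" using edg[OF PP gc(1)] gc by simp
      then obtain b where b: "b \<in> ends G g" "b \<in> B" using gc by auto
      have "g \<noteq> f" using gc(2) fB P[OF PP] by auto
      then show ?thesis using inT[OF N g(1) b] g b gc by auto
    qed
    then obtain \<phi> where \<phi>: "\<And>P. P \<in> \<Q> N \<Longrightarrow>
        \<exists>g. g \<in> N \<and> \<phi> P \<in> T N \<and> \<phi> P \<in> ends G g \<and> ends G g \<inter> P \<noteq> {}" by metis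
    have inj: "inj_on \<phi> (\<Q> N)"
    proof (rule inj_onI)
      fix P Q assume PQ: "P \<in> \<Q> N" "Q \<in> \<Q> N" "\<phi> P = \<phi> Q"
      obtain g where g: "g \<in> N" "\<phi> P \<in> T N" "\<phi> P \<in> ends G g" "ends G g \<inter> P \<noteq> {}"
        using \<phi>[OF PQ(1)] by blast
      obtain h where h: "h \<in> N" "\<phi> Q \<in> ends G h" "ends G h \<inter> Q \<noteq> {}"
        using \<phi>[OF PQ(2)] by blast
      have "h = g" using perfect_matching_unique[OF N h(1) g(1) h(2)] g(3) PQ(3) by simp
      obtain p where p: "p \<in> ends G g" "p \<in> P" using g by auto
      obtain q where q: "q \<in> ends G g" "q \<in> Q" using h \<open>h = g\<close> by auto
      have PP: "P \<in> \<P>" "Q \<in> \<P>" using QP PQ by auto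
      have "\<phi> P \<in> B" using g TB by auto
      then have "p \<noteq> \<phi> P" "q \<noteq> \<phi> P" using p q P(1)[OF PP(1)] P(1)[OF PP(2)] by auto
      then have "p = q"
        using edge_ends_eq[OF G perfect_matching_edges[OF N g(1)] g(3) p(1)] q by auto
      then show "P = Q" using dis PP p q by blast
    qed
    have sub: "\<phi> ` \<Q> N \<subseteq> T N" using \<phi> by blast
    have "card (\<phi> ` \<Q> N) = card (\<Q> N)" using inj by (rule card_image)
    then have "\<phi> ` \<Q> N = T N"
      using sub cTQ[of N] finite_subset[OF TB finB] by (intro card_seteq) auto
    then show ?thesis using inj \<phi> by blast
  qed
  \<comment> \<open>As \<open>\<phi>\<close> is onto, every edge of \<open>N\<close> at a vertex of \<open>B\<close>, except \<open>f\<close>, leads to one of the odd sets.\<close>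
  have hit: "\<exists>\<phi>. \<forall>g b. g \<in> N \<longrightarrow> b \<in> ends G g \<longrightarrow> b \<in> B \<longrightarrow> g \<noteq> f \<longrightarrow>
       (\<exists>Q\<in>\<Q> N. b = \<phi> Q \<and> ends G g \<inter> Q \<noteq> {})" if N: "perfect_matching G N" for N
  proof -
    obtain \<phi> where \<phi>: "\<phi> ` \<Q> N = T N"
      "\<forall>P\<in>\<Q> N. \<exists>g\<in>N. \<phi> P \<in> ends G g \<and> ends G g \<inter> P \<noteq> {}"
      using key[OF N] by (elim exE conjE) (rule that)
    show ?thesis
    proof (intro exI[of _ \<phi>] allI impI)
      fix g b
      assume g: "g \<in> N" "b \<in> ends G g" "b \<in> B" "g \<noteq> f"
      have "b \<in> \<phi> ` \<Q> N" using inT[OF N g] \<phi>(1) by simp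
      then obtain Q where Q: "Q \<in> \<Q> N" "b = \<phi> Q" by auto
      obtain h where h: "h \<in> N" "\<phi> Q \<in> ends G h" "ends G h \<inter> Q \<noteq> {}"
        using \<phi>(2) Q(1) by blast
      have "h = g" using perfect_matching_unique[OF N h(1) g(1)] h(2) g(2) Q(2) by blast
      then show "\<exists>Q\<in>\<Q> N. b = \<phi> Q \<and> ends G g \<inter> Q \<noteq> {}" using Q h by blast
    qed
  qed
  have meets: "\<exists>Q\<in>\<P>. ends G g \<inter> Q \<noteq> {}"
    if N: "perfect_matching G N" "g \<in> N" and b: "b \<in> ends G g" "b \<in> B" "g \<noteq> f" for N g b
  proof -
    obtain \<phi> where \<phi>: "\<forall>g b. g \<in> N \<longrightarrow> b \<in> ends G g \<longrightarrow> b \<in> B \<longrightarrow> g \<noteq> f \<longrightarrow>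
       (\<exists>Q\<in>\<Q> N. b = \<phi> Q \<and> ends G g \<inter> Q \<noteq> {})"
      using hit[OF N(1)] by (elim exE) (rule that)
    then show ?thesis using N(2) b QP by (meson subsetD)
  qed
  have one: "P = Q" if PQ: "P \<in> \<P>" "Q \<in> \<P>" and g: "g \<in> edges G" "b \<in> ends G g" "b \<in> B"
      and meet: "ends G g \<inter> P \<noteq> {}" "ends G g \<inter> Q \<noteq> {}" for P Q g b
  proof -
    obtain p q where pq: "p \<in> ends G g" "p \<in> P" "q \<in> ends G g" "q \<in> Q" using meet by auto
    then have "p \<noteq> b" "q \<noteq> b" using P(1)[OF PQ(1)] P(1)[OF PQ(2)] g(3) by auto
    then have "p = q" using edge_ends_eq[OF G g(1,2) pq(1)] pq(3) by auto
    then show ?thesis using dis pq PQ by blast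
  qed
  have cutB: "\<exists>b. b \<in> ends G g \<and> b \<in> B" and cutf: "g \<noteq> f"
    if "P \<in> \<P>" "g \<in> edge_cut G P" "g \<noteq> e" for g P
  proof -
    have gc: "g \<in> edges G" "ends G g \<inter> P \<noteq> {}" "\<not> ends G g \<subseteq> P"
      using that(2) unfolding edge_cut_def by auto
    show "\<exists>b. b \<in> ends G g \<and> b \<in> B" using edg[OF that(1) gc(1) that(3) gc(2)] gc by auto
    show "g \<noteq> f" using gc(2) fB P[OF that(1)] by auto
  qed
  have tight: "tight_cut G P" if PP: "P \<in> \<P>" for P
    unfolding tight_cut_def
  proof (intro allI impI)
    fix N assume N: "perfect_matching G N"
    obtain \<phi> where \<phi>: "\<forall>g b. g \<in> N \<longrightarrow> b \<in> ends G g \<longrightarrow> b \<in> B \<longrightarrow> g \<noteq> f \<longrightarrow>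
       (\<exists>Q\<in>\<Q> N. b = \<phi> Q \<and> ends G g \<inter> Q \<noteq> {})"
      using hit[OF N] by (elim exE) (rule that)
    have *: "P \<in> \<Q> N \<and> \<phi> P \<in> ends G g" if g: "g \<in> N" "g \<in> edge_cut G P" "g \<noteq> e" for g
    proof -
      obtain b where b: "b \<in> ends G g" "b \<in> B" using cutB[OF PP g(2,3)] by blast
      obtain Q where Q: "Q \<in> \<Q> N" "b = \<phi> Q" "ends G g \<inter> Q \<noteq> {}"
        using \<phi> g(1) b cutf[OF PP g(2,3)] by metis
      have "P = Q" using one[OF PP _ perfect_matching_edges[OF N g(1)] b _ Q(3)] Q(1) QP g(2)
        unfolding edge_cut_def by auto
      then show ?thesis using Q b by simp
    qed
    have "g = h" if g: "g \<in> N" "g \<in> edge_cut G P" and h: "h \<in> N" "h \<in> edge_cut G P" for g h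
    proof -
      have eQ: "P \<notin> \<Q> N" if "e \<in> N" "e \<in> edge_cut G P"
        using that unfolding \<Q>_def edge_cut_def by auto
      show ?thesis
      proof (cases "g = e \<or> h = e")
        case True
        then show ?thesis using eQ *[OF g] *[OF h] g h by metis
      next
        case False
        then show ?thesis using *[OF g] *[OF h] perfect_matching_unique[OF N g(1) h(1)] by blast
      qed
    qed
    moreover obtain c where "c \<in> N" "c \<in> edge_cut G P"
      using odd_set_meets_cut[OF G N, of P] P[OF PP] by auto
    ultimately show "\<exists>!c. c \<in> N \<and> c \<in> edge_cut G P" by blast
  qed
  have cPB: "card \<P> = card B"
  proof -
    have "T M0 = B" "\<Q> M0 = \<P>" using M0(2) unfolding T_def \<Q>_def by auto
    then show ?thesis using key[OF M0(1)] card_image by metis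
  qed
  obtain Ne where Ne: "perfect_matching G Ne" "e \<in> Ne"
    using adm ef(2) unfolding all_admissible_def by blast
  have eends: "ends G e \<subseteq> \<Union>\<P> \<and> (\<forall>P\<in>\<P>. \<not> ends G e \<subseteq> P)"
  proof -
    let ?R = "{P \<in> \<P>. ends G e \<inter> P \<noteq> {}}"
    have "card (\<Q> Ne) = card (T Ne)" using key[OF Ne(1)] card_image by metis
    moreover have "T Ne = B - ends G f" using Ne(2) unfolding T_def by auto
    then have "card (T Ne) = card S"
      using cB fs(2) card_Diff_subset[OF finite_subset[OF fB finB] fB] by simp
    moreover have "\<Q> Ne = \<P> - ?R" using Ne(2) unfolding \<Q>_def by auto
    then have "card (\<Q> Ne) = card \<P> - card ?R"
      using finP card_Diff_subset[of ?R \<P>] by simp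
    moreover have "card ?R \<le> card \<P>" using finP by (intro card_mono) auto
    ultimately have "card ?R \<ge> 2" using cP by linarith
    then obtain P Q where PQ: "P \<in> ?R" "Q \<in> ?R" "P \<noteq> Q"
      by (metis (no_types, lifting) card_2_iff' card_le_Suc_iff insert_iff numeral_2_eq_2 obtain_subset_with_card_n subsetD)
    obtain p q where pq: "p \<in> ends G e" "p \<in> P" "q \<in> ends G e" "q \<in> Q" using PQ by auto
    have ne: "P \<inter> Q = {}" using dis PQ by blast
    then have "p \<noteq> q" using pq by auto
    then have eq: "ends G e = {p, q}" using edge_ends_eq[OF G ef(2) pq(1,3)] by simp
    have "\<not> ends G e \<subseteq> R" if "R \<in> \<P>" for R
    proof
      assume "ends G e \<subseteq> R"
      then have "R \<inter> P \<noteq> {}" "R \<inter> Q \<noteq> {}" using eq pq by auto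
      then have "R = P" "R = Q" using dis that PQ by auto
      then show False using PQ by simp
    qed
    then show ?thesis using eq pq PQ by auto
  qed
  have PB: "B \<inter> \<Union>\<P> = {}" using P(1) by blast
  have cover: "vertices G = B \<union> \<Union>\<P>"
  proof (rule ccontr)
    assume ne: "vertices G \<noteq> B \<union> \<Union>\<P>"
    let ?R = "vertices G - (B \<union> \<Union>\<P>)"
    have sub: "B \<union> \<Union>\<P> \<subseteq> vertices G" using BV P(1) by blast
    then have "?R \<noteq> {}" using ne by auto
    moreover have "B \<noteq> {}" using cB by auto
    then have "?R \<noteq> vertices G" using BV by auto
    ultimately have "edge_cut G ?R \<noteq> {}"
      using conn unfolding cut_connected_def by simp
    then obtain h where "h \<in> edge_cut G ?R" by (metis ex_in_conv)
    then obtain a c where h: "h \<in> edges G" "a \<in> ends G h" "a \<in> ?R" "c \<in> ends G h" "c \<notin> ?R"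
      unfolding edge_cut_def by blast
    have cV: "c \<in> vertices G" using edge_ends_subset[OF G h(1)] h by auto
    have "h \<noteq> e" using eends h by auto
    have noP: "ends G h \<inter> P = {}" if "P \<in> \<P>" for P
      using edg[OF that h(1) \<open>h \<noteq> e\<close>] h(2,3) that by blast
    then have cB: "c \<in> B" using h(4,5) cV by blast
    have "h \<noteq> f" using fB h by auto
    obtain N where N: "perfect_matching G N" "h \<in> N"
      using adm h(1) unfolding all_admissible_def by blast
    show False using meets[OF N h(4) cB \<open>h \<noteq> f\<close>] noP by blast
  qed
  have inB: "g = f" if g: "g \<in> edges G" "ends G g \<subseteq> B" for g
  proof (rule ccontr)
    assume "g \<noteq> f"
    obtain b where b: "b \<in> ends G g" using edge_ends_nonempty[OF G g(1)] by auto
    obtain N where N: "perfect_matching G N" "g \<in> N"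
      using adm g(1) unfolding all_admissible_def by blast
    have "b \<in> B" using b g(2) by auto
    then show False using meets[OF N b _ \<open>g \<noteq> f\<close>] PB g(2) by blast
  qed
  have "dependence_barrier G e f B \<P>"
    unfolding dependence_barrier_def
    using fB PB cover cPB P(2) tight eends dis edg inB by simp
  then show thesis by (rule that)
qed

section \<open>Directed graphs in which every arc lies on a cycle\<close>

lemma shortest_walk_injective:
  fixes R :: "('a \<times> 'a) set"
  assumes "(a, b) \<in> R\<^sup>*"
  obtains n and w :: "nat \<Rightarrow> 'a" where "w 0 = a" "w n = b" "\<And>i. i < n \<Longrightarrow> (w i, w (Suc i)) \<in> R"
    "inj_on w {..n}"
proof -
  obtain n where n: "(a, b) \<in> R ^^ n" "\<And>m. (a, b) \<in> R ^^ m \<Longrightarrow> n \<le> m"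
    using exists_least_iff[of "\<lambda>n. (a, b) \<in> R ^^ n"] rtrancl_imp_relpow[OF assms] not_le by metis
  obtain w where w: "w 0 = a" "w n = b" "\<forall>i<n. (w i, w (Suc i)) \<in> R"
    using n(1) unfolding relpow_fun_conv by blast
  have walk: "(w i, w (i + k)) \<in> R ^^ k" if "i + k \<le> n" for i k
    using that by (induction k) (use w(3) in auto)
  have ne: "w i \<noteq> w j" if ij: "i < j" "j \<le> n" for i j
  proof
    assume eq: "w i = w j"
    have "(a, w i) \<in> R ^^ i" using walk[of 0 i] ij w(1) by simp
    moreover have "(w i, b) \<in> R ^^ (n - j)" using walk[of j "n - j"] ij w(2) eq by simp
    ultimately have "(a, b) \<in> R ^^ (i + (n - j))" unfolding relpow_add by blast
    then show False using n(2) ij by fastforce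
  qed
  have "inj_on w {..n}"
    by (rule inj_onI) (metis atMost_iff ne nat_neq_iff)
  then show thesis using that w by blast
qed

text \<open>Take for \<open>u\<close> a vertex at maximum distance from the root \<open>y\<close>, and for \<open>w0\<close> the first vertex after \<open>u\<close> on some
path back to \<open>y\<close>. An arc from \<open>u\<close> to another vertex \<open>w\<close> can be bypassed: go to \<open>y\<close> through \<open>w0\<close> and then
from \<open>y\<close> to \<open>w\<close> along a shortest path, which does not leave \<open>u\<close> because \<open>u\<close> is farthest.\<close>

lemma unavoidable_out_arc_unique:
  fixes R :: "('a \<times> 'a) set"
  assumes fin: "finite R" and bak: "\<And>a b. (a, b) \<in> R \<Longrightarrow> (b, a) \<in> R\<^sup>*"
    and z: "(y, z) \<in> R\<^sup>*" "z \<noteq> y"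
  obtains u w0 where "u \<noteq> y" "(y, u) \<in> R\<^sup>*" "(u, w0) \<in> R"
    "\<And>w. (u, w) \<in> R \<Longrightarrow> w \<noteq> w0 \<Longrightarrow> (u, w) \<in> (R - {(u, w)})\<^sup>*"
proof -
  define d where "d a = (LEAST n. (y, a) \<in> R ^^ n)" for a
  have dle: "d a \<le> n" if "(y, a) \<in> R ^^ n" for a n unfolding d_def using that by (rule Least_le)
  have dex: "(y, a) \<in> R ^^ d a" if "(y, a) \<in> R\<^sup>*" for a
    unfolding d_def using rtrancl_imp_relpow[OF that] by (metis LeastI)
  let ?V = "{a. (y, a) \<in> R\<^sup>*}"
  have "?V \<subseteq> insert y (snd ` R)"
  proof
    fix a assume "a \<in> ?V"
    then have "(y, a) \<in> R\<^sup>*" by simp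
    then show "a \<in> insert y (snd ` R)" by (cases rule: rtranclE) force+
  qed
  then have fV: "finite ?V" using fin finite_subset by blast
  have "Max (d ` ?V) \<in> d ` ?V" using fV z(1) by (intro Max_in) auto
  then obtain u where u0: "u \<in> ?V" "d u = Max (d ` ?V)" by auto
  have u: "u \<in> ?V" "\<And>a. a \<in> ?V \<Longrightarrow> d a \<le> d u" using u0 fV by auto
  have "d z \<noteq> 0" using dex[OF z(1)] z(2) by (metis relpow_0_E)
  then have "d u \<noteq> 0" using u(2)[of z] z(1) by simp
  moreover have "d y = 0" using dle[of y 0] by simp
  ultimately have uy: "u \<noteq> y" by metis
  let ?S = "R - {u} \<times> UNIV"
  have out: "(y, w) \<in> ?S\<^sup>*" if "(y, w) \<in> R ^^ m" "m \<le> d u" for w m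
    using that
  proof (induction m arbitrary: w)
    case 0
    then show ?case by simp
  next
    case (Suc m)
    then obtain v where v: "(y, v) \<in> R ^^ m" "(v, w) \<in> R" by auto
    have "v \<noteq> u" using dle[OF v(1)] Suc.prems by auto
    then show ?case using Suc.IH[OF v(1)] Suc.prems v(2) by (auto intro: rtrancl_into_rtrancl)
  qed
  have bk: "(b, a) \<in> R\<^sup>*" if "(a, b) \<in> R\<^sup>*" for a b
    using that by (induction rule: rtrancl_induct) (auto dest: bak intro: rtrancl_trans)
  have "(a, y) \<in> ?S\<^sup>* \<or> (\<exists>w0. (u, w0) \<in> R \<and> (w0, y) \<in> ?S\<^sup>*)" if "(a, y) \<in> R\<^sup>*" for a
    using that
  proof (induction rule: converse_rtrancl_induct)
    case base
    then show ?case by simp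
  next
    case (step a b)
    then show ?case by (cases "a = u") (auto intro: converse_rtrancl_into_rtrancl)
  qed
  moreover have "(u, y) \<in> R\<^sup>*" using bk u(1) by simp
  moreover have "(u, y) \<notin> ?S\<^sup>*" using uy by (auto elim: converse_rtranclE)
  ultimately obtain w0 where w0: "(u, w0) \<in> R" "(w0, y) \<in> ?S\<^sup>*" by blast
  have "(u, w) \<in> (R - {(u, w)})\<^sup>*" if w: "(u, w) \<in> R" "w \<noteq> w0" for w
  proof -
    have sub: "?S\<^sup>* \<subseteq> (R - {(u, w)})\<^sup>*" by (rule rtrancl_mono) auto
    have "(u, w0) \<in> R - {(u, w)}" using w0 w by auto
    then have "(u, y) \<in> (R - {(u, w)})\<^sup>*" using w0(2) sub by (meson converse_rtrancl_into_rtrancl subsetD)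
    moreover have yw: "(y, w) \<in> R\<^sup>*" using u(1) w(1) by (simp add: rtrancl_into_rtrancl)
    then have "(y, w) \<in> ?S\<^sup>*" using out[OF dex[OF yw]] u(2) by simp
    then have "(y, w) \<in> (R - {(u, w)})\<^sup>*" using sub by blast
    ultimately show ?thesis by (rule rtrancl_trans)
  qed
  then show thesis using that[OF uy _ w0(1)] u(1) by simp
qed

text \<open>Spanning subgraphs with in-degree and out-degree 1 everywhere, for the directed multigraph whose arcs \<open>h\<close>
run from \<open>s h\<close> to \<open>t h\<close>. In a bipartite graph with a fixed perfect matching, contracting the matching edges
to loops turns perfect matchings into such factors.\<close>

definition cycle_factor :: "('e \<Rightarrow> 'a) \<Rightarrow> ('e \<Rightarrow> 'a) \<Rightarrow> 'a set \<Rightarrow> 'e set \<Rightarrow> bool" where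
  "cycle_factor s t A N \<longleftrightarrow> bij_betw s N A \<and> bij_betw t N A"

definition arcs :: "('e \<Rightarrow> 'a) \<Rightarrow> ('e \<Rightarrow> 'a) \<Rightarrow> 'e set \<Rightarrow> ('a \<times> 'a) set" where
  "arcs s t H = (\<lambda>h. (s h, t h)) ` H"

text \<open>A shortest path from the head of \<open>f\<close> back to its tail closes to a cycle; all vertices off the cycle
use their loops \<open>l\<close>.\<close>

lemma cycle_factor_through:
  assumes fin: "finite A" and H: "s ` K \<subseteq> A" "t ` K \<subseteq> A"
    and l: "\<And>a. a \<in> A \<Longrightarrow> s (l a) = a \<and> t (l a) = a"
    and f: "f \<in> K" "(t f, s f) \<in> (arcs s t K)\<^sup>*"
  obtains N where "N \<subseteq> K \<union> l ` A" "f \<in> N" "cycle_factor s t A N"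
proof -
  obtain n and w :: "nat \<Rightarrow> 'a" where w: "w 0 = t f" "w n = s f"
    "\<And>i. i < n \<Longrightarrow> (w i, w (Suc i)) \<in> arcs s t K" "inj_on w {..n}"
    using shortest_walk_injective[OF f(2)] by metis
  \<comment> \<open>The arc leaving \<open>w i\<close> on the cycle; the last one is \<open>f\<close>, which returns to \<open>w 0\<close>.\<close>
  have "\<exists>h. i \<le> n \<longrightarrow> h \<in> K \<and> s h = w i \<and> t h = (if i < n then w (Suc i) else w 0) \<and> (i = n \<longrightarrow> h = f)" for i
  proof (cases "i < n")
    case True
    then show ?thesis using w(3)[of i] unfolding arcs_def by auto
  next
    case False
    then show ?thesis using w(1,2) f(1) by (intro exI[of _ f]) auto
  qed
  then obtain c where c: "\<And>i. i \<le> n \<Longrightarrow> c i \<in> K \<and> s (c i) = w i \<and>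
      t (c i) = (if i < n then w (Suc i) else w 0) \<and> (i = n \<longrightarrow> c i = f)" by metis
  have wA: "w i \<in> A" if "i \<le> n" for i
    using c[OF that] H by (metis image_subset_iff)
  define g where "g a = (if a \<in> w ` {..n} then c (the_inv_into {..n} w a) else l a)" for a
  have gw: "g (w i) = c i" if "i \<le> n" for i
    unfolding g_def using that the_inv_into_f_f[OF w(4)] by simp
  have gl: "g a = l a" if "a \<notin> w ` {..n}" for a unfolding g_def using that by simp
  have sg: "s (g a) = a" if "a \<in> A" for a
  proof (cases "a \<in> w ` {..n}")
    case True
    then obtain i where "i \<le> n" "a = w i" by auto
    then show ?thesis using gw c by simp
  next
    case False
    then show ?thesis using gl l that by simp
  qed
  have "A \<subseteq> (t \<circ> g) ` A"
  proof
    fix a assume a: "a \<in> A"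
    show "a \<in> (t \<circ> g) ` A"
    proof (cases "a \<in> w ` {..n}")
      case True
      then obtain i where i: "i \<le> n" "a = w i" by auto
      show ?thesis
      proof (cases i)
        case 0
        then have "(t \<circ> g) (w n) = a" using gw[of n] c[of n] i w(1) by simp
        then show ?thesis using wA[of n] by (metis imageI le_refl)
      next
        case (Suc j)
        then have "(t \<circ> g) (w j) = a" using gw[of j] c[of j] i by simp
        then show ?thesis using wA[of j] i Suc by (metis imageI Suc_leD)
      qed
    next
      case False
      then have "(t \<circ> g) a = a" using gl l a by simp
      then show ?thesis using a by (metis imageI)
    qed
  qed
  moreover have "(t \<circ> g) ` A \<subseteq> A"
  proof
    fix b assume "b \<in> (t \<circ> g) ` A"
    then obtain a where a: "a \<in> A" "b = t (g a)" by auto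
    show "b \<in> A"
    proof (cases "a \<in> w ` {..n}")
      case True
      then obtain i where i: "i \<le> n" "a = w i" by auto
      then have "b = t (c i)" "c i \<in> K" using a gw[of i] c[of i] by auto
      then show ?thesis using H by auto
    next
      case False
      then show ?thesis using a gl l by simp
    qed
  qed
  ultimately have im: "(t \<circ> g) ` A = A" by auto
  then have "inj_on (t \<circ> g) A" using fin by (simp add: eq_card_imp_inj_on)
  then have "inj_on t (g ` A)" by (rule inj_on_imageI)
  then have "bij_betw t (g ` A) A" using im unfolding bij_betw_def by (simp add: image_comp)
  moreover have "bij_betw s (g ` A) A"
    by (rule bij_betw_byWitness[of _ g]) (use sg in auto)
  moreover have "g ` A \<subseteq> K \<union> l ` A"
    unfolding g_def using c w(4) by (auto simp: the_inv_into_f_f)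
  moreover have "f \<in> g ` A" using gw[of n] c[of n] wA[of n] by (metis image_eqI le_refl)
  ultimately show thesis using that unfolding cycle_factor_def by blast
qed

text \<open>The vertices reachable from the head of \<open>f\<close> are mapped into themselves by the permutation \<open>N\<close>, hence onto
themselves, so the tail of \<open>f\<close> is among them.\<close>

lemma cycle_factor_returns:
  assumes fin: "finite A" and N: "N \<subseteq> H" "cycle_factor s t A N" "f \<in> N"
  shows "(t f, s f) \<in> (arcs s t H)\<^sup>*"
proof -
  have bij: "bij_betw s N A" "bij_betw t N A" using N unfolding cycle_factor_def by auto
  let ?R = "{a \<in> A. (t f, a) \<in> (arcs s t H)\<^sup>*}"
  let ?N = "{h \<in> N. s h \<in> ?R}"
  have "s ` ?N = ?R" using bij(1) unfolding bij_betw_def by auto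
  moreover have "inj_on s ?N" using bij(1) unfolding bij_betw_def by (auto intro: inj_on_subset)
  ultimately have 1: "card ?N = card ?R" using card_image[of s ?N] by simp
  have "inj_on t ?N" using bij(2) unfolding bij_betw_def by (auto intro: inj_on_subset)
  then have 2: "card (t ` ?N) = card ?N" by (rule card_image)
  have "t ` ?N \<subseteq> ?R"
  proof
    fix b assume "b \<in> t ` ?N"
    then obtain h where h: "h \<in> N" "s h \<in> ?R" "b = t h" by auto
    have "(s h, b) \<in> arcs s t H" using h N(1) unfolding arcs_def by auto
    moreover have "b \<in> A" using h bij(2) unfolding bij_betw_def by auto
    ultimately show "b \<in> ?R" using h(2) by (auto intro: rtrancl_into_rtrancl)
  qed
  then have eq: "t ` ?N = ?R" using 1 2 fin by (intro card_seteq) auto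
  have "t f \<in> ?R" using N bij(2) unfolding bij_betw_def by auto
  then obtain h where h: "h \<in> ?N" "t h = t f" using eq by (metis (no_types, lifting) imageE)
  then have "h = f" using bij(2) N(3) unfolding bij_betw_def inj_on_def by auto
  then show ?thesis using h by simp
qed

text \<open>The two exceptional arcs at \<open>u\<close> are the loop \<open>l u\<close> and one arc to the vertex \<open>w0\<close> of the previous
construction. Arcs parallel to them are avoidable, which is why the arcs and not their heads are excluded.
The graph may be disconnected: the root is \<open>x\<close> if \<open>x\<close> reaches another vertex, and otherwise any other vertex \<open>y\<close>,
whose component then does not contain \<open>x\<close>.\<close>

lemma vertex_with_two_unavoidable_arcs:
  assumes fin: "finite A" "finite H" and H: "s ` H \<subseteq> A" "t ` H \<subseteq> A"
    and l: "\<And>a. a \<in> A \<Longrightarrow> l a \<in> H \<and> s (l a) = a \<and> t (l a) = a"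
    and fac: "\<And>h. h \<in> H \<Longrightarrow> \<exists>N\<subseteq>H. cycle_factor s t A N \<and> h \<in> N"
    and x: "x \<in> A" "card A \<ge> 2"
  obtains u h0 h1 where "u \<in> A" "u \<noteq> x"
    "\<And>q f. q \<in> H \<Longrightarrow> s q = u \<Longrightarrow> q \<noteq> h0 \<Longrightarrow> q \<noteq> h1 \<Longrightarrow> f \<in> H \<Longrightarrow> f \<noteq> q \<Longrightarrow>
       \<exists>N\<subseteq>H. cycle_factor s t A N \<and> f \<in> N \<and> q \<notin> N"
proof -
  note result = that
  let ?R = "arcs s t H"
  have finR: "finite ?R" using fin unfolding arcs_def by simp
  have RA: "?R \<subseteq> A \<times> A" using H unfolding arcs_def by auto
  have ret: "(t f, s f) \<in> ?R\<^sup>*" if f: "f \<in> H" for f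
  proof -
    obtain N where "N \<subseteq> H" "cycle_factor s t A N" "f \<in> N" using fac[OF f] by blast
    then show ?thesis by (rule cycle_factor_returns[OF fin(1)])
  qed
  have bak: "(b, a) \<in> ?R\<^sup>*" if "(a, b) \<in> ?R" for a b
    using that ret unfolding arcs_def by auto
  have bk: "(b, a) \<in> ?R\<^sup>*" if "(a, b) \<in> ?R\<^sup>*" for a b
    using that by (induction rule: rtrancl_induct) (auto dest: bak intro: rtrancl_trans)
  have inA: "b \<in> A" if "(a, b) \<in> ?R\<^sup>*" "a \<in> A" for a b
    using that RA by (induction rule: rtrancl_induct) auto
  have main: thesis if u: "u \<in> A" "u \<noteq> x" and w0: "(u, w0) \<in> ?R"
    and alt: "\<And>w. (u, w) \<in> ?R \<Longrightarrow> w \<noteq> w0 \<Longrightarrow> (u, w) \<in> (?R - {(u, w)})\<^sup>*" for u w0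
  proof -
    obtain h1 where h1: "h1 \<in> H" "s h1 = u" "t h1 = w0" using w0 unfolding arcs_def by auto
    have "\<exists>N\<subseteq>H. cycle_factor s t A N \<and> f \<in> N \<and> q \<notin> N"
      if q: "q \<in> H" "s q = u" "q \<noteq> l u" "q \<noteq> h1" and f: "f \<in> H" "f \<noteq> q" for q f
    proof -
      let ?K = "H - {q}"
      have R1: "?R - {(u, t q)} \<subseteq> arcs s t ?K" using q(2) unfolding arcs_def by auto
      have "(u, t q) \<in> (arcs s t ?K)\<^sup>*"
      proof (cases "t q = w0")
        case True
        then have "(u, t q) \<in> arcs s t ?K" using h1 q(4) unfolding arcs_def by force
        then show ?thesis by auto
      next
        case False
        have "(u, t q) \<in> ?R" using q unfolding arcs_def by auto
        then show ?thesis using alt[OF _ False] rtrancl_mono[OF R1] by blast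
      qed
      then have "?R \<subseteq> (arcs s t ?K)\<^sup>*" using R1 by auto
      then have R2: "?R\<^sup>* \<subseteq> (arcs s t ?K)\<^sup>*" by (metis rtrancl_idemp rtrancl_mono)
      have ll: "\<And>a. a \<in> A \<Longrightarrow> s (l a) = a \<and> t (l a) = a" using l by blast
      have K: "s ` ?K \<subseteq> A" "t ` ?K \<subseteq> A" using H by auto
      have fK: "f \<in> ?K" using f by simp
      have cl: "(t f, s f) \<in> (arcs s t ?K)\<^sup>*" using ret[OF f(1)] R2 by blast
      obtain N where N: "N \<subseteq> ?K \<union> l ` A" "f \<in> N" "cycle_factor s t A N"
        using cycle_factor_through[OF fin(1) K ll fK cl] .
      have "q \<notin> l ` A" using q(2,3) l by auto
      then have "q \<notin> N" using N(1) by auto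
      moreover have "N \<subseteq> H" using N(1) l by auto
      ultimately show ?thesis using N by blast
    qed
    then show thesis by (rule result[OF u])
  qed
  have nontriv: thesis if y: "y \<in> A" "(y, z) \<in> ?R\<^sup>*" "z \<noteq> y" and x': "x = y \<or> (y, x) \<notin> ?R\<^sup>*" for y z
  proof -
    obtain u w0 where u: "u \<noteq> y" "(y, u) \<in> ?R\<^sup>*" "(u, w0) \<in> ?R"
      "\<And>w. (u, w) \<in> ?R \<Longrightarrow> w \<noteq> w0 \<Longrightarrow> (u, w) \<in> (?R - {(u, w)})\<^sup>*"
      using unavoidable_out_arc_unique[OF finR bak y(2,3)] by metis
    have "u \<noteq> x" using x' u(1,2) by auto
    then show thesis using main[OF inA[OF u(2) y(1)] _ u(3,4)] by blast
  qed
  show thesis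
  proof (cases "\<exists>z. (x, z) \<in> ?R\<^sup>* \<and> z \<noteq> x")
    case True
    then show thesis using nontriv[OF x(1)] by blast
  next
    case False
    have "\<not> A \<subseteq> {x}" using x card_mono[of "{x}" A] by auto
    then obtain y where y: "y \<in> A" "y \<noteq> x" by blast
    have yx: "(y, x) \<notin> ?R\<^sup>*" using bk False y by blast
    show thesis
    proof (cases "\<exists>z. (y, z) \<in> ?R\<^sup>* \<and> z \<noteq> y")
      case True
      then show thesis using nontriv[OF y(1)] yx by blast
    next
      case False
      have "(y, y) \<in> ?R" using l[OF y(1)] unfolding arcs_def by force
      moreover have "w = y" if "(y, w) \<in> ?R" for w using False that by blast
      ultimately show thesis using main[OF y] by blast
    qed
  qed
qed

section \<open>The near-bipartite case\<close>

lemma bij_betw_iff_unique: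
  "bij_betw s N A \<longleftrightarrow> (\<forall>h\<in>N. s h \<in> A) \<and> (\<forall>v\<in>A. \<exists>!h. h \<in> N \<and> s h = v)"
proof
  assume b: "bij_betw s N A"
  then have "\<forall>h\<in>N. s h \<in> A" unfolding bij_betw_def by auto
  moreover have "\<exists>!h. h \<in> N \<and> s h = v" if v: "v \<in> A" for v
    using b v unfolding bij_betw_def inj_on_def by (metis imageE)
  ultimately show "(\<forall>h\<in>N. s h \<in> A) \<and> (\<forall>v\<in>A. \<exists>!h. h \<in> N \<and> s h = v)" by blast
next
  assume a: "(\<forall>h\<in>N. s h \<in> A) \<and> (\<forall>v\<in>A. \<exists>!h. h \<in> N \<and> s h = v)"
  then have "inj_on s N" by (intro inj_onI) metis
  moreover have "s ` N = A" using a by (auto simp: image_iff)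
  ultimately show "bij_betw s N A" unfolding bij_betw_def by simp
qed

text \<open>Perfect matchings inside \<open>H\<close>, the edges that do not depend on \<open>e\<close>, are those that avoid \<open>e\<close>. An edge \<open>q\<close> at \<open>u\<close> that is solo
with respect to \<open>H\<close> is not solo in \<open>G\<close>, so an edge \<open>g\<close> outside \<open>H\<close> depends on it; as \<open>e\<close> is a source, \<open>e\<close> depends
on \<open>g\<close> and so on \<open>q\<close>. Edges outside \<open>H\<close> are also ones that \<open>e\<close> depends on. All these lie in one perfect
matching \<open>Me\<close>, which has one edge at \<open>u\<close>.\<close>

lemma bipartite_vertex_of_degree_at_most_three:
  assumes G: "loopless_multigraph G" and adm: "all_admissible G"
    and V: "vertices G = A \<union> A'" "A \<inter> A' = {}"
    and e: "e \<in> edges G" "\<And>h. h \<in> edges G \<Longrightarrow> depends_on G h e \<Longrightarrow> depends_on G e h"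
    and M0: "perfect_matching G M0" "e \<notin> M0"
    and cross: "\<And>h. h \<in> edges G \<Longrightarrow> \<not> depends_on G h e \<Longrightarrow> \<exists>a\<in>A. \<exists>b\<in>A'. ends G h = {a, b}"
    and x: "x \<in> A" "card A \<ge> 2"
    and nonsolo: "\<And>h. h \<in> edges G \<Longrightarrow> x \<notin> ends G h \<Longrightarrow> \<not> solo G h"
  shows "\<exists>u\<in>A. u \<noteq> x \<and> vertex_degree G u \<le> 3"
proof -
  define H where "H = {h \<in> edges G. \<not> depends_on G h e}"
  have fin: "finite A" "finite H" "finite (edges G)"
    using loopless_finite[OF G] V(1) unfolding H_def by auto
  have "\<forall>h. \<exists>a b. h \<in> H \<longrightarrow> a \<in> A \<and> b \<in> A' \<and> ends G h = {a, b}"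
    using cross unfolding H_def by blast
  then obtain s b where sb: "\<And>h. h \<in> H \<Longrightarrow> s h \<in> A \<and> b h \<in> A' \<and> ends G h = {s h, b h}"
    by metis
  have s_iff: "v \<in> ends G h \<longleftrightarrow> s h = v" if "h \<in> H" "v \<in> A" for h v
    using sb[OF that(1)] that(2) V(2) by auto
  have b_iff: "v \<in> ends G h \<longleftrightarrow> b h = v" if "h \<in> H" "v \<in> A'" for h v
    using sb[OF that(1)] that(2) V(2) by auto
  have pm: "perfect_matching G N \<longleftrightarrow> bij_betw s N A \<and> bij_betw b N A'" if N: "N \<subseteq> H" for N
  proof -
    have "(\<exists>!h. h \<in> N \<and> v \<in> ends G h) \<longleftrightarrow> (\<exists>!h. h \<in> N \<and> s h = v)" if "v \<in> A" for v
      using s_iff that N by (metis subsetD)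
    moreover have "(\<exists>!h. h \<in> N \<and> v \<in> ends G h) \<longleftrightarrow> (\<exists>!h. h \<in> N \<and> b h = v)" if "v \<in> A'" for v
      using b_iff that N by (metis subsetD)
    moreover have "N \<subseteq> edges G" using N unfolding H_def by auto
    moreover have "\<forall>h\<in>N. s h \<in> A" "\<forall>h\<in>N. b h \<in> A'" using sb N by auto
    ultimately show ?thesis
      unfolding perfect_matching_iff[OF G] bij_betw_iff_unique V(1) by (simp add: ball_Un)
  qed
  have inH: "N \<subseteq> H" if N: "perfect_matching G N" "e \<notin> N" for N
    using N perfect_matching_edges[OF N(1)] unfolding H_def depends_on_def by auto
  have M0b: "bij_betw s M0 A" "bij_betw b M0 A'" using pm[OF inH[OF M0]] M0(1) by auto
  define m where "m = the_inv_into M0 b"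
  have mb: "bij_betw m A' M0" unfolding m_def by (rule bij_betw_the_inv_into[OF M0b(2)])
  have mM: "m (b h) = h" if "h \<in> M0" for h
    unfolding m_def using the_inv_into_f_f[OF bij_betw_imp_inj_on[OF M0b(2)] that] .
  have smb: "bij_betw (s \<circ> m) A' A" by (rule bij_betw_trans[OF mb M0b(1)])
  \<comment> \<open>\<open>t h\<close> is the partner under \<open>M0\<close> of the end of \<open>h\<close> in \<open>A'\<close>, so the edges of \<open>M0\<close> become loops.\<close>
  define t where "t = (s \<circ> m) \<circ> b"
  have factor: "cycle_factor s t A N \<longleftrightarrow> perfect_matching G N" if N: "N \<subseteq> H" for N
  proof -
    have "b ` N \<subseteq> A'" using sb N by auto
    then have "bij_betw t N A \<longleftrightarrow> bij_betw b N A'"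
      unfolding t_def by (rule bij_betw_comp_iff2[OF smb, symmetric])
    then show ?thesis unfolding cycle_factor_def using pm[OF N] by simp
  qed
  define l where "l = the_inv_into M0 s"
  have lM: "l a \<in> M0" "s (l a) = a" if "a \<in> A" for a
  proof -
    have "bij_betw l A M0" unfolding l_def by (rule bij_betw_the_inv_into[OF M0b(1)])
    then show "l a \<in> M0" using that unfolding bij_betw_def by auto
    show "s (l a) = a" unfolding l_def using f_the_inv_into_f_bij_betw[OF M0b(1)] that by blast
  qed
  have l: "l a \<in> H \<and> s (l a) = a \<and> t (l a) = a" if "a \<in> A" for a
    using lM[OF that] inH[OF M0] mM[of "l a"] unfolding t_def by auto
  have sH: "s ` H \<subseteq> A" using sb by auto
  have tH: "t ` H \<subseteq> A"
  proof
    fix a assume "a \<in> t ` H"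
    then obtain h where "h \<in> H" "a = (s \<circ> m) (b h)" unfolding t_def by auto
    then show "a \<in> A" using sb smb unfolding bij_betw_def by auto
  qed
  have fac: "\<exists>N\<subseteq>H. cycle_factor s t A N \<and> h \<in> N" if h: "h \<in> H" for h
  proof -
    obtain N where N: "perfect_matching G N" "h \<in> N" "e \<notin> N"
      using h unfolding H_def depends_on_def by blast
    have "N \<subseteq> H" using inH[OF N(1,3)] .
    then show ?thesis using factor[of N] N by blast
  qed
  obtain u h0 h1 where u: "u \<in> A" "u \<noteq> x"
    and alt: "\<And>q f. q \<in> H \<Longrightarrow> s q = u \<Longrightarrow> q \<noteq> h0 \<Longrightarrow> q \<noteq> h1 \<Longrightarrow> f \<in> H \<Longrightarrow> f \<noteq> q \<Longrightarrow>
       \<exists>N\<subseteq>H. cycle_factor s t A N \<and> f \<in> N \<and> q \<notin> N"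
    using vertex_with_two_unavoidable_arcs[OF fin(1,2) sH tH l fac x] by metis
  obtain Me where Me: "perfect_matching G Me" "e \<in> Me"
    using adm e(1) unfolding all_admissible_def by blast
  have above: "q \<in> Me" if "depends_on G e q" for q
    using that Me unfolding depends_on_def by blast
  have rest: "q \<in> Me" if q: "q \<in> edges G" "u \<in> ends G q" "q \<noteq> h0" "q \<noteq> h1" for q
  proof (cases "q \<in> H")
    case False
    then have "depends_on G q e" using q(1) unfolding H_def by simp
    then show ?thesis using above e(2) q(1) by blast
  next
    case True
    have sq: "s q = u" using s_iff[OF True u(1)] q(2) by simp
    have "x \<notin> ends G q" using s_iff[OF True x(1)] sq u(2) by simp
    then obtain g where g: "g \<in> edges G" "depends_on G g q" "g \<noteq> q"
      using nonsolo[OF q(1)] q(1) unfolding solo_def by blast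
    have "g \<notin> H"
    proof
      assume gH: "g \<in> H"
      obtain N where N: "N \<subseteq> H" "cycle_factor s t A N" "g \<in> N" "q \<notin> N"
        using alt[OF True sq q(3,4) gH g(3)] by blast
      then show False using factor[OF N(1)] g(2) unfolding depends_on_def by blast
    qed
    then have "depends_on G e g" using e(2)[OF g(1)] g(1) unfolding H_def by simp
    then have "depends_on G e q" using g(2) unfolding depends_on_def by blast
    then show ?thesis by (rule above)
  qed
  obtain g where g: "\<And>q. q \<in> Me \<Longrightarrow> u \<in> ends G q \<Longrightarrow> q = g"
    using perfect_matching_unique[OF Me(1)] perfect_matching_covers[OF Me(1), of u] u(1) V(1) by blast
  have "{q \<in> edges G. u \<in> ends G q} \<subseteq> {h0, h1, g}" using rest g by blast
  then have "vertex_degree G u \<le> card {h0, h1, g}"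
    unfolding vertex_degree_def by (intro card_mono) auto
  also have "\<dots> \<le> 3" by (simp add: card_insert_if)
  finally show ?thesis using u by blast
qed

lemma contract_degree:
  assumes "r \<in> X" "v \<notin> X"
  shows "vertex_degree (contract G X r) v = vertex_degree G v"
proof -
  have "{e \<in> edges (contract G X r). v \<in> ends (contract G X r) e} = {e \<in> edges G. v \<in> ends G e}"
    using contract_ends_other[OF assms, of G] assms(2) unfolding contract_simps by auto
  then show ?thesis unfolding vertex_degree_def by simp
qed

lemma contract_degree_new:
  assumes "r \<in> X"
  shows "vertex_degree (contract G X r) r = card (edge_cut G X)"
proof -
  have "{e \<in> edges (contract G X r). r \<in> ends (contract G X r) e} = edge_cut G X"
    using contract_ends_new[OF assms, of G] unfolding contract_simps edge_cut_def by auto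
  then show ?thesis unfolding vertex_degree_def by simp
qed

text \<open>Sending an edge to a solo edge that depends on it is injective on the edges at any vertex \<open>v\<close>: two
edges with the same image lie in a common perfect matching. The images are edges at \<open>x\<close>.\<close>

lemma solo_edges_star:
  assumes G: "loopless_multigraph G" and adm: "all_admissible G"
    and x: "x \<in> vertices G"
    and nonsolo: "\<And>h. h \<in> edges G \<Longrightarrow> x \<notin> ends G h \<Longrightarrow> \<not> solo G h"
    and dom: "\<And>e. e \<in> edges G \<Longrightarrow> \<exists>r. solo G r \<and> depends_on G r e"
  shows "\<And>e. e \<in> edges G \<Longrightarrow> x \<in> ends G e \<Longrightarrow> solo G e"
    and "\<And>v. v \<in> vertices G \<Longrightarrow> vertex_degree G v \<le> vertex_degree G x"
proof -
  have "\<exists>r N. solo G r \<and> x \<in> ends G r \<and> depends_on G r e \<and> perfect_matching G N \<and> r \<in> N \<and> e \<in> N"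
    if e: "e \<in> edges G" for e
  proof -
    obtain r where r: "solo G r" "depends_on G r e" using dom[OF e] by blast
    then have rE: "r \<in> edges G" unfolding solo_def by simp
    obtain N where "perfect_matching G N" "r \<in> N"
      using adm rE unfolding all_admissible_def by blast
    then show ?thesis using r nonsolo[OF rE] unfolding depends_on_def by blast
  qed
  then obtain r where r: "\<And>e. e \<in> edges G \<Longrightarrow> solo G (r e) \<and> x \<in> ends G (r e) \<and> depends_on G (r e) e
      \<and> (\<exists>N. perfect_matching G N \<and> r e \<in> N \<and> e \<in> N)" by metis
  show "solo G e" if e: "e \<in> edges G" "x \<in> ends G e" for e
  proof -
    obtain N where N: "perfect_matching G N" "r e \<in> N" "e \<in> N" using r[OF e(1)] by blast
    have "r e = e" using perfect_matching_unique[OF N(1) N(2) N(3) _ e(2)] r[OF e(1)] by blast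
    then show ?thesis using r[OF e(1)] by simp
  qed
  show "vertex_degree G v \<le> vertex_degree G x" if v: "v \<in> vertices G" for v
    unfolding vertex_degree_def
  proof (rule card_inj_on_le)
    show "inj_on r {e \<in> edges G. v \<in> ends G e}"
    proof (rule inj_onI)
      fix e e' assume a: "e \<in> {e \<in> edges G. v \<in> ends G e}" "e' \<in> {e \<in> edges G. v \<in> ends G e}"
        "r e = r e'"
      then obtain N where N: "perfect_matching G N" "r e \<in> N" "e \<in> N" using r[of e] by blast
      have "e' \<in> N" using N(1,2) a r[of e'] unfolding depends_on_def by auto
      then show "e = e'" using perfect_matching_unique[OF N(1) N(3)] a by blast
    qed
    show "r ` {e \<in> edges G. v \<in> ends G e} \<subseteq> {e \<in> edges G. x \<in> ends G e}"
      using r unfolding solo_def by auto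
    show "finite {e \<in> edges G. x \<in> ends G e}" using loopless_finite[OF G] by simp
  qed
qed

lemma source_edge_exists:
  assumes fin: "finite (edges G)" and e0: "e0 \<in> edges G"
  obtains e where "e \<in> edges G" "depends_on G e e0"
    "\<And>h. h \<in> edges G \<Longrightarrow> depends_on G h e \<Longrightarrow> depends_on G e h"
proof -
  let ?P = "\<lambda>e. e \<in> edges G \<and> depends_on G e e0"
  let ?D = "\<lambda>e. {h \<in> edges G. depends_on G h e}"
  have "?P e0" using e0 unfolding depends_on_def by simp
  then obtain e where e: "?P e" "\<And>e'. ?P e' \<Longrightarrow> card (?D e) \<le> card (?D e')"
    using ex_has_least_nat[of ?P e0 "\<lambda>e. card (?D e)"] by blast
  have "depends_on G e h" if h: "h \<in> edges G" "depends_on G h e" for h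
  proof (rule ccontr)
    assume n: "\<not> depends_on G e h"
    have "?D h \<subseteq> ?D e" using h(2) unfolding depends_on_def by blast
    moreover have "e \<in> ?D e" using e(1) unfolding depends_on_def by simp
    moreover have "e \<notin> ?D h" using n by simp
    ultimately have "?D h \<subset> ?D e" by blast
    then have "card (?D h) < card (?D e)" using fin by (intro psubset_card_mono) auto
    moreover have "?P h" using h e(1) unfolding depends_on_def by blast
    ultimately show False using e(2)[of h] by simp
  qed
  then show thesis using that e(1) by blast
qed

section \<open>Induction over tight cuts\<close>

text \<open>The hypotheses of the induction. The exceptional vertex \<open>x\<close> may stand for a contracted shore, at which solo
edges do occur and whose degree is only bounded afterwards, by \<open>solo_edges_star\<close>.\<close>

definition solo_star_graph :: "('v, 'e) multigraph \<Rightarrow> 'v \<Rightarrow> bool" where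
  "solo_star_graph G x \<longleftrightarrow>
     loopless_multigraph G \<and> all_admissible G \<and> cut_connected G \<and> 4 \<le> card (vertices G) \<and>
     x \<in> vertices G \<and> (\<forall>v\<in>vertices G - {x}. 4 \<le> vertex_degree G v) \<and>
     (\<forall>h\<in>edges G. x \<notin> ends G h \<longrightarrow> \<not> solo G h)"

lemma solo_star_graphD:
  assumes "solo_star_graph G x"
  shows "loopless_multigraph G" "all_admissible G" "cut_connected G" "4 \<le> card (vertices G)"
    "x \<in> vertices G" "\<And>v. v \<in> vertices G \<Longrightarrow> v \<noteq> x \<Longrightarrow> 4 \<le> vertex_degree G v"
    "\<And>h. h \<in> edges G \<Longrightarrow> x \<notin> ends G h \<Longrightarrow> \<not> solo G h"
  using assms unfolding solo_star_graph_def by auto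

text \<open>The representative of the shore that contains \<open>x\<close> is \<open>x\<close> itself, so the exceptional vertex is preserved.
If \<open>x \<notin> X\<close>, the new vertex \<open>p\<close> is an ordinary one, and both its degree and the edges at it must be controlled:
this is where the induction hypothesis is applied to the contraction \<open>G2\<close> of the other shore.\<close>

lemma solo_star_contract_part:
  assumes G: "solo_star_graph G x"
    and split: "tight_split G X p s" and xs: "if x \<in> X then x = p else x = s"
    and X: "3 \<le> card X" "3 \<le> card (vertices G - X)"
    and IH: "\<And>K :: ('v, 'e) multigraph. card (vertices K) < card (vertices G) \<Longrightarrow> solo_star_graph K x \<Longrightarrow>
       \<forall>e\<in>edges K. \<exists>r. solo K r \<and> depends_on K r e"
  shows "solo_star_graph (contract (G :: ('v, 'e) multigraph) X p) x"
    and "card (vertices (contract G X p)) < card (vertices G)"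
proof -
  interpret tight_split G X p s by (rule split)
  note D = solo_star_graphD[OF G]
  have fV: "finite (vertices G)" using loopless_finite[OF D(1)] by simp
  have fX: "finite X" using finite_subset[OF shore(1) fV] .
  have n: "card (vertices G) = card X + card (vertices G - X)"
    using card_mono[OF fV shore(1)] by (simp add: card_Diff_subset[OF fX shore(1)])
  have v1: "card (vertices G1) = Suc (card (vertices G - X))"
    unfolding contract_simps using fV shore(2) by simp
  have dd: "vertices G - (vertices G - X) = X" using shore(1) by auto
  have v2: "card (vertices G2) = Suc (card X)"
    unfolding contract_simps dd using fX shore(3) by simp
  show less: "card (vertices G1) < card (vertices G)" using n v1 X by simp
  have x1: "x \<in> vertices G1" using xs shore D(5) unfolding contract_simps by auto
  have nonsolo_out: "\<not> solo G1 h" if h: "h \<in> edges G1" "x \<notin> ends G1 h"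
    and h2: "h \<in> edges G2 \<Longrightarrow> solo G2 h" and out: "x \<notin> ends G h" for h
  proof
    assume "solo G1 h"
    then have "solo G h" by (rule solo_glue[OF h(1) _ h2])
    then show False using D(7) out unfolding solo_def by blast
  qed
  have "(\<forall>v\<in>vertices G1 - {x}. 4 \<le> vertex_degree G1 v) \<and>
     (\<forall>h\<in>edges G1. x \<notin> ends G1 h \<longrightarrow> \<not> solo G1 h)"
  proof (cases "x \<in> X")
    case True
    then have xp: "x = p" using xs by simp
    have "4 \<le> vertex_degree G1 v" if v: "v \<in> vertices G1 - {x}" for v
    proof -
      have "v \<in> vertices G" "v \<notin> X" using v xp unfolding contract_simps by auto
      then show ?thesis using D(6)[of v] contract_degree[OF shore(2), of v G] True by auto
    qed
    moreover have "\<not> solo G1 h" if h: "h \<in> edges G1" "x \<notin> ends G1 h" for h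
    proof -
      have "h \<notin> edges G2" using cut_iff1[OF h(1)] cut_iff[of h] h xp by simp
      moreover have "ends G h \<inter> X = {}" using contract_ends_new[OF shore(2), of G h] h(2) xp by simp
      then have "x \<notin> ends G h" using True by auto
      ultimately show ?thesis using nonsolo_out[OF h] by simp
    qed
    ultimately show ?thesis by blast
  next
    case False
    then have xs: "x = s" using xs by simp
    have s: "s \<in> vertices G - X" using shore by simp
    have "solo_star_graph G2 x"
      unfolding solo_star_graph_def
    proof (intro conjI ballI impI)
      show "loopless_multigraph G2" by (rule loopless2)
      show "all_admissible G2" by (rule tight_split.admissible1[OF swap])
      show "cut_connected G2" by (rule tight_split.conn1[OF swap])
      show "4 \<le> card (vertices G2)" using v2 X by simp
      show "x \<in> vertices G2" unfolding contract_simps xs by simp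
    next
      fix v assume "v \<in> vertices G2 - {x}"
      then have v: "v \<in> vertices G" "v \<in> X" "v \<notin> vertices G - X"
        using xs shore(1) unfolding contract_simps by auto
      then show "4 \<le> vertex_degree G2 v"
        using D(6)[of v] contract_degree[OF s, of v G] False by auto
    next
      fix h assume h: "h \<in> edges G2" "x \<notin> ends G2 h"
      have "h \<notin> edge_cut G (vertices G - X)" using tight_split.cut_iff1[OF swap h(1)] h(2) xs by simp
      then have h1: "h \<notin> edges G1" using cut_iff[of h] h(1) edge_cut_complement[OF loopless, of X] by simp
      have "ends G h \<inter> (vertices G - X) = {}"
        using contract_ends_new[OF s, of G h] h(2) xs by simp
      then have "x \<notin> ends G h" using xs s by auto
      moreover have "h \<in> edges G" using h(1) unfolding contract_simps by simp
      moreover have "solo G h" if "solo G2 h"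
      proof (rule tight_split.solo_glue[OF swap h(1) that])
        assume "h \<in> edges (contract G (vertices G - (vertices G - X)) p)"
        then show "solo (contract G (vertices G - (vertices G - X)) p) h" using h1 dd by simp
      qed
      ultimately show "\<not> solo G2 h" using D(7) by blast
    qed
    note star2 = this
    have "card (vertices G2) < card (vertices G)" using n v2 X by simp
    then have dom2: "\<forall>e\<in>edges G2. \<exists>r. solo G2 r \<and> depends_on G2 r e" using IH[OF _ star2] by simp
    note D2 = solo_star_graphD[OF star2]
    have solo2: "solo G2 e" if "e \<in> edges G2" "x \<in> ends G2 e" for e
      using solo_edges_star(1)[OF D2(1,2,5) D2(7) _ that] dom2 by blast
    have deg2: "vertex_degree G2 v \<le> vertex_degree G2 x" if "v \<in> vertices G2" for v
      using solo_edges_star(2)[OF D2(1,2,5) D2(7) _ that] dom2 by blast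
    have "p \<in> vertices G2" "p \<noteq> x" using shore xs unfolding contract_simps by auto
    then have "4 \<le> vertex_degree G2 x" using D2(6)[of p] deg2[of p] by simp
    then have cut: "4 \<le> card (edge_cut G X)"
      using contract_degree_new[OF s, of G] edge_cut_complement[OF loopless, of X] xs by simp
    have "4 \<le> vertex_degree G1 v" if v: "v \<in> vertices G1 - {x}" for v
    proof (cases "v = p")
      case True
      then show ?thesis using contract_degree_new[OF shore(2), of G] cut by simp
    next
      case False
      then have "v \<in> vertices G" "v \<notin> X" using v unfolding contract_simps by auto
      then show ?thesis using D(6)[of v] contract_degree[OF shore(2), of v G] v by auto
    qed
    moreover have "\<not> solo G1 h" if h: "h \<in> edges G1" "x \<notin> ends G1 h" for h
    proof (rule nonsolo_out[OF h])
      show "x \<notin> ends G h" using contract_ends_other[OF shore(2) False, of G h] h(2) by simp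
      assume h2: "h \<in> edges G2"
      then have "h \<in> edge_cut G (vertices G - X)"
        using cut_iff[of h] h(1) edge_cut_complement[OF loopless, of X] by simp
      then have "x \<in> ends G2 h" using tight_split.cut_iff1[OF swap h2] xs by simp
      then show "solo G2 h" using solo2[OF h2] by simp
    qed
    ultimately show ?thesis by blast
  qed
  then show "solo_star_graph G1 x"
    unfolding solo_star_graph_def
    using loopless1 admissible1 conn1 v1 X x1 by simp
qed

lemma edge_not_dependent_exists:
  assumes G: "loopless_multigraph G" "all_admissible G"
    and e: "e \<in> edges G" "u \<in> ends G e" "2 \<le> vertex_degree G u"
  obtains M where "perfect_matching G M" "e \<notin> M"
proof -
  have "\<not> {g \<in> edges G. u \<in> ends G g} \<subseteq> {e}"
    using e(3) card_mono[of "{e}" "{g \<in> edges G. u \<in> ends G g}"] unfolding vertex_degree_def by fastforce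
  then obtain g where g: "g \<in> edges G" "u \<in> ends G g" "g \<noteq> e" by blast
  obtain M where M: "perfect_matching G M" "g \<in> M"
    using G(2) g(1) unfolding all_admissible_def by blast
  have "e \<notin> M" using perfect_matching_unique[OF M(1) M(2) _ g(2) e(2)] g(3) by blast
  then show thesis using that M by blast
qed

lemma barrier_singletons_bipartite:
  assumes G: "loopless_multigraph G" and bar: "dependence_barrier G e f B \<P>"
    and single: "\<And>P. P \<in> \<P> \<Longrightarrow> card P = 1"
    and h: "h \<in> edges G" "h \<noteq> e" "h \<noteq> f"
  shows "\<exists>a\<in>B. \<exists>b\<in>\<Union>\<P>. ends G h = {a, b}"
proof -
  have bs: "vertices G = B \<union> \<Union>\<P>" "B \<inter> \<Union>\<P> = {}" using bar unfolding dependence_barrier_def by auto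
  have "\<not> ends G h \<subseteq> B" using bar h unfolding dependence_barrier_def by blast
  then obtain k where k: "k \<in> ends G h" "k \<notin> B" by blast
  then have "k \<in> \<Union>\<P>" using edge_ends_subset[OF G h(1)] bs(1) by blast
  then obtain P where P: "P \<in> \<P>" "k \<in> P" by blast
  have "P = {k}" using single[OF P(1)] P(2) by (metis card_1_singletonE singletonD)
  moreover have "ends G h \<subseteq> P \<union> B"
    using bar P(1) h k(1) P(2) unfolding dependence_barrier_def by blast
  moreover obtain b where b: "ends G h = {k, b}" "k \<noteq> b" using edge_ends_two[OF G h(1) k(1)] by metis
  ultimately have "b \<in> B" by auto
  then show ?thesis using b P by (metis UnionI insert_commute)
qed

text \<open>Both \<open>e\<close> and \<open>f\<close> survive the contraction of a part. A solo edge \<open>r\<close> above \<open>e\<close> in the contraction is above \<open>e\<close>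
in \<open>G\<close>, so, as \<open>e\<close> is a source, \<open>e\<close> and \<open>f\<close> depend on \<open>r\<close>, in \<open>G\<close> and then also in the contraction. That
forces \<open>e = r = f\<close>.\<close>

lemma solo_edges_dominate:
  assumes "solo_star_graph G x"
  shows "\<forall>e\<in>edges G. \<exists>r. solo G r \<and> depends_on G r e"
  using assms
proof (induction "card (vertices G)" arbitrary: G rule: less_induct)
  case less
  note D = solo_star_graphD[OF less.prems]
  have IH: "\<forall>e\<in>edges K. \<exists>r. solo K r \<and> depends_on K r e"
    if "card (vertices K) < card (vertices G)" "solo_star_graph K x" for K :: "('a, 'b) multigraph"
    using less.hyps that by blast
  show ?case
  proof (rule ccontr)
    assume "\<not> ?case"
    then obtain e0 where e0: "e0 \<in> edges G" "\<And>r. solo G r \<Longrightarrow> \<not> depends_on G r e0" by blast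
    obtain e where e: "e \<in> edges G" "depends_on G e e0"
      and src: "\<And>h. h \<in> edges G \<Longrightarrow> depends_on G h e \<Longrightarrow> depends_on G e h"
      using source_edge_exists[OF loopless_finite(2)[OF D(1)] e0(1)] by metis
    have "\<not> solo G e" using e e0(2) by blast
    then obtain f where f: "f \<in> edges G" "depends_on G f e" "f \<noteq> e"
      using e(1) unfolding solo_def by blast
    have ef: "depends_on G e f" using src f by blast
    have e2: "card (ends G e) = 2" "card (ends G f) = 2"
      using D(1) e(1) f(1) unfolding loopless_multigraph_def by auto
    then have "\<not> ends G e \<subseteq> {x}" using card_mono[of "{x}" "ends G e"] by fastforce
    then obtain v where v: "v \<in> ends G e" "v \<noteq> x" by blast
    have "2 \<le> vertex_degree G v" using D(6)[of v] v edge_ends_subset[OF D(1) e(1)] by fastforce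
    then obtain M0 where M0: "perfect_matching G M0" "e \<notin> M0"
      using edge_not_dependent_exists[OF D(1,2) e(1) v(1)] by blast
    obtain B \<P> where bar: "dependence_barrier G e f B \<P>"
      using barrier_of_dependent_pair[OF D(1-3) f(3)[symmetric] e(1) f(1,2) ef M0] .
    have bs: "ends G f \<subseteq> B" "B \<inter> \<Union>\<P> = {}" "vertices G = B \<union> \<Union>\<P>" "card \<P> = card B"
        "ends G e \<subseteq> \<Union>\<P>"
      and P: "\<And>P. P \<in> \<P> \<Longrightarrow> odd (card P) \<and> tight_cut G P \<and> \<not> ends G e \<subseteq> P"
      and dis: "\<And>P Q. P \<in> \<P> \<Longrightarrow> Q \<in> \<P> \<Longrightarrow> P \<noteq> Q \<Longrightarrow> P \<inter> Q = {}"
      using bar unfolding dependence_barrier_def by simp_all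
    have fin: "finite B" "finite (\<Union>\<P>)" using loopless_finite(1)[OF D(1)] bs(3) by auto
    have B2: "2 \<le> card B" using card_mono[OF fin(1) bs(1)] e2 by simp
    have K2: "2 \<le> card (\<Union>\<P>)" using card_mono[OF fin(2) bs(5)] e2 by simp
    show False
    proof (cases "\<forall>P\<in>\<P>. card P = 1")
      case True
      have cross: "\<exists>a\<in>B. \<exists>b\<in>\<Union>\<P>. ends G h = {a, b}"
        if h: "h \<in> edges G" "\<not> depends_on G h e" for h
      proof -
        have "h \<noteq> e" "h \<noteq> f" using h(2) f(2) unfolding depends_on_def by auto
        then show ?thesis using barrier_singletons_bipartite[OF D(1) bar _ h(1)] True by simp
      qed
      have "\<exists>u\<in>vertices G. u \<noteq> x \<and> vertex_degree G u \<le> 3"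
      proof (cases "x \<in> B")
        case True
        then show ?thesis
          using bipartite_vertex_of_degree_at_most_three[OF D(1,2) bs(3,2) e(1) src M0 cross _ B2 D(7)] bs(3)
          by blast
      next
        case False
        have V: "vertices G = \<Union>\<P> \<union> B" "\<Union>\<P> \<inter> B = {}" using bs by auto
        have cross': "\<exists>a\<in>\<Union>\<P>. \<exists>b\<in>B. ends G h = {a, b}"
          if h: "h \<in> edges G" "\<not> depends_on G h e" for h
          using cross[OF h] by (metis insert_commute)
        have "x \<in> \<Union>\<P>" using False D(5) bs(3) by blast
        then show ?thesis
          using bipartite_vertex_of_degree_at_most_three[OF D(1,2) V e(1) src M0 cross' _ K2 D(7)] bs(3)
          by blast
      qed
      then show False using D(6) by fastforce
    next
      case False
      then obtain X where X: "X \<in> \<P>" "card X \<noteq> 1" by blast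
      have oX: "odd (card X)" and tX: "tight_cut G X" and eX: "\<not> ends G e \<subseteq> X" using P[OF X(1)] by auto
      have X3: "3 \<le> card X" using oX X(2) by presburger
      have XV: "X \<subseteq> vertices G" and XB: "X \<inter> B = {}" using X(1) bs by auto
      have C3: "3 \<le> card (vertices G - X)"
      proof -
        obtain q where q: "q \<in> ends G e" "q \<notin> X" using eX by blast
        then have qq: "q \<in> \<Union>\<P>" using bs(5) by blast
        then have "q \<notin> B" using bs(2) by blast
        then have "card (insert q B) = Suc (card B)" using fin by simp
        moreover have "insert q B \<subseteq> vertices G - X" using q qq XB bs(3) by auto
        then have "card (insert q B) \<le> card (vertices G - X)"
          using loopless_finite(1)[OF D(1)] by (intro card_mono) auto
        ultimately show ?thesis using B2 by simp
      qed
      have "X \<noteq> {}" using X3 by auto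
      moreover have "vertices G - X \<noteq> {}" using C3 by (metis card.empty not_numeral_le_zero)
      ultimately have "X \<noteq> {}" "vertices G - X \<noteq> {}" by simp_all
      then obtain p s where ps: "p \<in> X" "s \<in> vertices G - X" "if x \<in> X then x = p else x = s"
        using D(5) by (metis Diff_iff ex_in_conv)
      have split: "tight_split G X p s"
        by unfold_locales (use D(1-3) XV ps(1,2) tX in auto)
      interpret tight_split G X p s by (rule split)
      note star = solo_star_contract_part[OF less.prems split ps(3) X3 C3 IH]
      have e1: "e \<in> edges G1" using e(1) eX unfolding contract_simps by simp
      have "\<not> ends G f \<subseteq> X" using bs(1) XB edge_ends_nonempty[OF D(1) f(1)] by auto
      then have f1: "f \<in> edges G1" using f(1) unfolding contract_simps by simp
      obtain r where r: "solo G1 r" "depends_on G1 r e" using IH[OF star(2,1)] e1 by blast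
      have r1: "r \<in> edges G1" using r(1) unfolding solo_def by simp
      then have "r \<in> edges G" unfolding contract_simps by simp
      then have er: "depends_on G e r" using src depends_lift1[OF r(2) r1] by blast
      then have fr: "depends_on G f r" using f(2) unfolding depends_on_def by blast
      have "e = r" using depends1[OF er r1] r(1) e1 unfolding solo_def by blast
      moreover have "f = r" using depends1[OF fr r1] r(1) f1 unfolding solo_def by blast
      ultimately show False using f(3) by simp
    qed
  qed
qed

section \<open>Minimal matching covered graphs\<close>

lemma connected_graph_cut_connected:
  assumes G: "loopless_multigraph G" and c: "connected_graph G"
  shows "cut_connected G"
  unfolding cut_connected_def
proof (intro allI impI notI)
  fix X assume X: "X \<subseteq> vertices G" "X \<noteq> {}" "X \<noteq> vertices G" and n: "edge_cut G X = {}"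
  obtain u v where uv: "u \<in> X" "v \<in> vertices G" "v \<notin> X" using X by blast
  have "(u, v) \<in> (adjacency G)\<^sup>*" using c uv X unfolding connected_graph_def by blast
  then have "v \<in> X"
  proof (induction rule: rtrancl_induct)
    case base
    then show ?case using uv by simp
  next
    case (step a b)
    then obtain e where e: "e \<in> edges G" "ends G e = {a, b}" unfolding adjacency_def by blast
    then have "e \<notin> edge_cut G X" using n by simp
    then show ?case using step.IH e unfolding edge_cut_def by auto
  qed
  then show False using uv by simp
qed

text \<open>If \<open>e\<close> were the only edge at \<open>v\<close>, with other end \<open>w\<close>, then every perfect matching would contain \<open>e\<close>, and a further edge
at \<open>w\<close> would lie in none.\<close>

lemma degree_at_least_two:
  assumes G: "loopless_multigraph G" "all_admissible G" "cut_connected G" "3 \<le> card (vertices G)"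
    and v: "v \<in> vertices G"
  shows "2 \<le> vertex_degree G v"
proof (rule ccontr)
  assume n: "\<not> ?thesis"
  have small: "X \<noteq> vertices G" if "card X \<le> 2" for X using G(4) that by auto
  have "edge_cut G {v} \<noteq> {}" using G(3) v small[of "{v}"] unfolding cut_connected_def by simp
  then obtain e where e: "e \<in> edges G" "v \<in> ends G e" unfolding edge_cut_def by blast
  let ?D = "{g \<in> edges G. v \<in> ends G g}"
  have "?D \<subseteq> {e}"
  proof
    fix g assume g: "g \<in> ?D"
    show "g \<in> {e}"
    proof (rule ccontr)
      assume "g \<notin> {e}"
      then have "card {e, g} = 2" by simp
      moreover have "card {e, g} \<le> card ?D"
        using e g loopless_finite(2)[OF G(1)] by (intro card_mono) auto
      ultimately show False using n unfolding vertex_degree_def by simp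
    qed
  qed
  then have only: "g = e" if "g \<in> edges G" "v \<in> ends G g" for g using that by blast
  obtain w where w: "ends G e = {v, w}" "v \<noteq> w" "w \<in> vertices G" using edge_ends_two[OF G(1) e] by metis
  have "card {v, w} \<le> 2" by (simp add: card_insert_if)
  then have "edge_cut G {v, w} \<noteq> {}" using G(3) v w(3) small[of "{v, w}"] unfolding cut_connected_def by simp
  then obtain g where g: "g \<in> edges G" "ends G g \<inter> {v, w} \<noteq> {}" "\<not> ends G g \<subseteq> {v, w}"
    unfolding edge_cut_def by blast
  have "g \<noteq> e" using g w by auto
  then have wg: "w \<in> ends G g" using only[OF g(1)] g(2) by blast
  obtain M where M: "perfect_matching G M" "g \<in> M"
    using G(2) g(1) unfolding all_admissible_def by blast
  obtain k where k: "k \<in> M" "v \<in> ends G k" using perfect_matching_covers[OF M(1) v] by blast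
  have "k = e" using only[OF perfect_matching_edges[OF M(1) k(1)] k(2)] .
  then have "g = e" using perfect_matching_unique[OF M(1) M(2) k(1) wg] w by simp
  then show False using \<open>g \<noteq> e\<close> by simp
qed

lemma perfect_matching_delete_edge:
  "perfect_matching (delete_edge G r) M \<longleftrightarrow> perfect_matching G M \<and> r \<notin> M"
  unfolding perfect_matching_def matching_def delete_edge_def by auto

text \<open>If \<open>X\<close> is odd, every perfect matching uses \<open>r\<close>, so all edges depend on \<open>r\<close> and \<open>r\<close> would be the only edge. If \<open>X\<close>
is even, no perfect matching uses \<open>r\<close>: the other vertices of \<open>X\<close> would be an odd set matched within itself.\<close>

lemma single_cut_edge_not_solo:
  assumes G: "loopless_multigraph G" "all_admissible G" "3 \<le> card (vertices G)"
    and r: "solo G r" and X: "X \<subseteq> vertices G" and cut: "edge_cut G X = {r}"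
  shows False
proof -
  have rE: "r \<in> edges G" using r unfolding solo_def by simp
  obtain M where M: "perfect_matching G M" "r \<in> M"
    using G(2) rE unfolding all_admissible_def by blast
  obtain a b where ab: "a \<in> ends G r" "a \<in> X" "b \<in> ends G r" "b \<notin> X"
    using cut unfolding edge_cut_def by blast
  have rab: "ends G r = {a, b}" using edge_ends_eq[OF G(1) rE ab(1,3)] ab by blast
  show False
  proof (cases "odd (card X)")
    case True
    have "depends_on G f r" for f
      using odd_set_meets_cut[OF G(1) _ X True] cut unfolding depends_on_def by auto
    then have single: "edges G \<subseteq> {r}" using r unfolding solo_def by blast
    have "vertices G \<subseteq> ends G r"
    proof
      fix v assume "v \<in> vertices G"
      then obtain e where e: "e \<in> M" "v \<in> ends G e" using perfect_matching_covers[OF M(1)] by blast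
      have "e = r" using single perfect_matching_edges[OF M(1) e(1)] by blast
      then show "v \<in> ends G r" using e by simp
    qed
    then have "card (vertices G) \<le> card {a, b}" unfolding rab by (intro card_mono) auto
    also have "\<dots> \<le> 2" by (simp add: card_insert_if)
    finally show False using G(3) by simp
  next
    case False
    have "finite X" using X loopless_finite(1)[OF G(1)] finite_subset by blast
    then have "card X = Suc (card (X - {a}))" using card_Suc_Diff1[of X a] ab(2) by simp
    then have "odd (card (X - {a}))" using False by simp
    then obtain g where g: "g \<in> M" "g \<in> edge_cut G (X - {a})"
      using odd_set_meets_cut[OF G(1) M(1), of "X - {a}"] X by blast
    have gc: "g \<in> edges G" "ends G g \<inter> (X - {a}) \<noteq> {}" "\<not> ends G g \<subseteq> X - {a}"
      using g(2) unfolding edge_cut_def by auto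
    have "g \<noteq> r" using gc(2) rab ab by auto
    then have "g \<notin> edge_cut G X" using cut by simp
    then have "a \<in> ends G g" using gc unfolding edge_cut_def by blast
    then show False using perfect_matching_unique[OF M(1) g(1) M(2) _ ab(1)] \<open>g \<noteq> r\<close> by blast
  qed
qed

lemma solo_edge_removable:
  assumes G: "loopless_multigraph G" "all_admissible G" "cut_connected G" "3 \<le> card (vertices G)"
    and r: "solo G r"
  shows "matching_covered (delete_edge G r)"
proof -
  let ?D = "delete_edge G r"
  have D: "vertices ?D = vertices G" "edges ?D = edges G - {r}" "ends ?D = ends G"
    unfolding delete_edge_def by simp_all
  have "\<exists>M. perfect_matching ?D M \<and> e \<in> M" if "e \<in> edges ?D" for e
    using that r unfolding D(2) perfect_matching_delete_edge solo_def depends_on_def by blast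
  moreover have "connected_graph ?D"
    unfolding connected_graph_def D(1)
  proof (intro conjI ballI)
    show "vertices G \<noteq> {}" using G(4) by auto
    fix u v assume uv: "u \<in> vertices G" "v \<in> vertices G"
    show "(u, v) \<in> (adjacency ?D)\<^sup>*"
    proof (rule ccontr)
      assume n: "(u, v) \<notin> (adjacency ?D)\<^sup>*"
      define X where "X = {w \<in> vertices G. (u, w) \<in> (adjacency ?D)\<^sup>*}"
      have X: "X \<subseteq> vertices G" "u \<in> X" "v \<notin> X" using uv n unfolding X_def by auto
      then have "edge_cut G X \<noteq> {}" using G(3) uv unfolding cut_connected_def by blast
      moreover have "g = r" if g: "g \<in> edge_cut G X" for g
      proof (rule ccontr)
        assume gr: "g \<noteq> r"
        obtain a b where ab: "g \<in> edges G" "a \<in> ends G g" "a \<in> X" "b \<in> ends G g" "b \<notin> X"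
          using g unfolding edge_cut_def by blast
        have "ends G g = {a, b}" using edge_ends_eq[OF G(1) ab(1,2,4)] ab by blast
        then have "(a, b) \<in> adjacency ?D" using ab(1) gr unfolding adjacency_def D by auto
        moreover have "(u, a) \<in> (adjacency ?D)\<^sup>*" using ab(3) unfolding X_def by simp
        ultimately have "(u, b) \<in> (adjacency ?D)\<^sup>*" by (rule rtrancl_into_rtrancl[rotated])
        then show False using ab edge_ends_subset[OF G(1) ab(1)] unfolding X_def by auto
      qed
      ultimately have "edge_cut G X = {r}" by blast
      then show False using single_cut_edge_not_solo[OF G(1,2,4) r X(1)] by simp
    qed
  qed
  ultimately show ?thesis unfolding matching_covered_def D(1) using G(4) by simp
qed

theorem theorem1p4:
  fixes G :: "('v, 'e) multigraph"
  assumes "loopless_multigraph G"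
    and "minimal_matching_covered G"
    and "card (vertices G) \<ge> 4"
  shows "min_degree G = 2 \<or> min_degree G = 3"
proof (rule ccontr)
  assume n: "\<not> ?thesis"
  have mc: "matching_covered G" using assms(2) unfolding minimal_matching_covered_def by simp
  have adm: "all_admissible G" using mc unfolding matching_covered_def all_admissible_def by simp
  have conn: "cut_connected G"
    using connected_graph_cut_connected[OF assms(1)] mc unfolding matching_covered_def by simp
  have three: "3 \<le> card (vertices G)" using assms(3) by simp
  have nonsolo: "\<not> solo G r" for r
    using solo_edge_removable[OF assms(1) adm conn three, of r] assms(2)
    unfolding minimal_matching_covered_def solo_def by blast
  let ?D = "vertex_degree G ` vertices G"
  obtain x where x: "x \<in> vertices G" using assms(3) by fastforce
  have fin: "finite ?D" "?D \<noteq> {}" using loopless_finite[OF assms(1)] x by auto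
  have "min_degree G \<in> ?D" unfolding min_degree_def using Min_in[OF fin] .
  then have "2 \<le> min_degree G" using degree_at_least_two[OF assms(1) adm conn three] by auto
  then have "4 \<le> min_degree G" using n by linarith
  then have four: "4 \<le> vertex_degree G v" if "v \<in> vertices G" for v
    using Min_le[OF fin(1), of "vertex_degree G v"] that unfolding min_degree_def by auto
  have "solo_star_graph G x"
    unfolding solo_star_graph_def using assms adm conn x four nonsolo by simp
  then have dom: "\<forall>e\<in>edges G. \<exists>r. solo G r \<and> depends_on G r e" by (rule solo_edges_dominate)
  have "edges G \<noteq> {}" using four[OF x] unfolding vertex_degree_def by auto
  then show False using dom nonsolo by blast
qed

end
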